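(* Let $\omega:\mathbb N\to[1,\infty)$ be any weight, i.e., $\omega(mn)\le\omega(m)\omega(n)$ for all $m,n\in\mathbb N$. Then the weighted Banach algebra of Dirichlet series $A_\omega$ (equivalently, $\ell^1(\mathbb N,\omega)$ with Dirichlet convolution) is a BSE-algebra; that is, $C_{\operatorname{BSE}}(\Phi_{A_\omega})=\widehat{\mathcal M(A_\omega)}$.
   Context: $\mathbb N=\{1,2,3,\ldots\}$, regarded as a semigroup under multiplication. For a weight $\omega:\mathbb N\to[1,\infty)$, $A_\omega$ is the collection of all functions $f:\mathbb H\to\mathbb C$, where $\mathbb H=\{x+iy\in\mathbb C:x\ge0\}$, that can be represented as $f(s)=\sum_{n=1}^\infty a(n)n^{-s}$ for all $s\in\mathbb H$ with $\|f\|_\omega=\sum_{n=1}^\infty|a(n)|\omega(n)<\infty$; it is a unital commutative Banach algebra under pointwise multiplication. It is isometrically isomorphic, via $(a(n))\mapsto\sum_n a(n)n^{-s}$, to $\ell^1(\mathbb N,\omega)=\{f=(a(n)):\mathbb N\to\mathbb C:\|f\|_\omega=\sum_n|a(n)|\omega(n)<\infty\}$ with the Dirichlet convolution $(f\star g)(n)=\sum_{d\mid n}f(d)g(n/d)$. For a commutative Banach algebra $A$, $\Phi_A$ is the set of all nonzero linear functionals $\varphi:A\to\mathbb C$ with $\varphi(ab)=\varphi(a)\varphi(b)$ for all $a,b\in A$. For $a\in A$, the Gel'fand transform $\widehat a:\Phi_A\to\mathbb C$ is $\widehat a(\varphi)=\varphi(a)$, and $\Phi_A$ carries the Gel'fand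 topology, the weakest topology making all $\widehat a$ $(a\in A)$ continuous. Let $A$ be a commutative Banach algebra without order (i.e., $aA=\{0\}$ implies $a=0$). A multiplier on $A$ is a map $T:A\to A$ with $T(ab)=aT(b)=T(a)b$ for all $a,b\in A$; $\mathcal M(A)$ is the set of all multipliers. For $T\in\mathcal M(A)$, $\widehat T:\Phi_A\to\mathbb C$ is the unique bounded continuous function with $\widehat{Ta}(\varphi)=\widehat T(\varphi)\widehat a(\varphi)$ for all $a\in A$, $\varphi\in\Phi_A$, and $\widehat{\mathcal M(A)}=\{\widehat T:T\in\mathcal M(A)\}$. (If $A$ is unital, then $\mathcal M(A)=A$ via $a\mapsto L_a$, $L_a(b)=ab$, so $\widehat{\mathcal M(A)}=\widehat A=\{\widehat a:a\in A\}$.) A continuous function $\sigma:\Phi_A\to\mathbb C$ is a BSE-function if there is a constant $C>0$ such that $\left|\sum_{i=1}^n c_i\sigma(\varphi_i)\right|\le C\left\|\sum_{i=1}^n c_i\varphi_i\right\|_{A^\ast}$ for all $n\in\mathbb N$, $\varphi_1,\ldots,\varphi_n\in\Phi_A$ and $c_1,\ldots,c_n\in\mathbb C$. $C_{\operatorname{BSE}}(\Phi_A)$ is the set of all BSE-functions. $A$ is a BSE-algebra if $C_{\operatorname{BSE}}(\Phi_A)=\widehat{\mathcal M(A)}$. *)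

theory Defs
  imports "HOL-Analysis.Analysis"
begin

section \<open>Commutative Banach algebras\<close>

text \<open>Algebras are carrier-based, since the algebras of interest depend on a weight.
  Every function whose domain is a carrier or a spectrum is taken to be extensional
  (\<open>undefined\<close> off its domain), so that equality of functions is equality on the domain.
  No unit is required.\<close>

record 'a complex_alg =
  alg_carrier :: "'a set"
  alg_zero :: "'a"
  alg_add :: "'a \<Rightarrow> 'a \<Rightarrow> 'a"
  alg_scale :: "complex \<Rightarrow> 'a \<Rightarrow> 'a"
  alg_mult :: "'a \<Rightarrow> 'a \<Rightarrow> 'a"
  alg_norm :: "'a \<Rightarrow> real"

definition alg_diff :: "'a complex_alg \<Rightarrow> 'a \<Rightarrow> 'a \<Rightarrow> 'a" where
  "alg_diff A x y = alg_add A x (alg_scale A (-1) y)"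

locale comm_banach_algebra =
  fixes A :: "'a complex_alg"
  assumes zero_closed: "alg_zero A \<in> alg_carrier A"
    and add_closed: "\<lbrakk>x \<in> alg_carrier A; y \<in> alg_carrier A\<rbrakk> \<Longrightarrow> alg_add A x y \<in> alg_carrier A"
    and scale_closed: "x \<in> alg_carrier A \<Longrightarrow> alg_scale A c x \<in> alg_carrier A"
    and mult_closed: "\<lbrakk>x \<in> alg_carrier A; y \<in> alg_carrier A\<rbrakk> \<Longrightarrow> alg_mult A x y \<in> alg_carrier A"
    and add_assoc: "\<lbrakk>x \<in> alg_carrier A; y \<in> alg_carrier A; z \<in> alg_carrier A\<rbrakk>
      \<Longrightarrow> alg_add A (alg_add A x y) z = alg_add A x (alg_add A y z)"
    and add_commute: "\<lbrakk>x \<in> alg_carrier A; y \<in> alg_carrier A\<rbrakk> \<Longrightarrow> alg_add A x y = alg_add A y x"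
    and add_zero: "x \<in> alg_carrier A \<Longrightarrow> alg_add A x (alg_zero A) = x"
    and diff_self: "x \<in> alg_carrier A \<Longrightarrow> alg_diff A x x = alg_zero A"
    and scale_add_right: "\<lbrakk>x \<in> alg_carrier A; y \<in> alg_carrier A\<rbrakk>
      \<Longrightarrow> alg_scale A c (alg_add A x y) = alg_add A (alg_scale A c x) (alg_scale A c y)"
    and scale_add_left: "x \<in> alg_carrier A
      \<Longrightarrow> alg_scale A (c + d) x = alg_add A (alg_scale A c x) (alg_scale A d x)"
    and scale_scale: "x \<in> alg_carrier A \<Longrightarrow> alg_scale A c (alg_scale A d x) = alg_scale A (c * d) x"
    and scale_one: "x \<in> alg_carrier A \<Longrightarrow> alg_scale A 1 x = x"
    and mult_assoc: "\<lbrakk>x \<in> alg_carrier A; y \<in> alg_carrier A; z \<in> alg_carrier A\<rbrakk>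
      \<Longrightarrow> alg_mult A (alg_mult A x y) z = alg_mult A x (alg_mult A y z)"
    and mult_commute: "\<lbrakk>x \<in> alg_carrier A; y \<in> alg_carrier A\<rbrakk> \<Longrightarrow> alg_mult A x y = alg_mult A y x"
    and mult_add: "\<lbrakk>x \<in> alg_carrier A; y \<in> alg_carrier A; z \<in> alg_carrier A\<rbrakk>
      \<Longrightarrow> alg_mult A x (alg_add A y z) = alg_add A (alg_mult A x y) (alg_mult A x z)"
    and mult_scale: "\<lbrakk>x \<in> alg_carrier A; y \<in> alg_carrier A\<rbrakk>
      \<Longrightarrow> alg_mult A x (alg_scale A c y) = alg_scale A c (alg_mult A x y)"
    and norm_nonneg: "x \<in> alg_carrier A \<Longrightarrow> 0 \<le> alg_norm A x"
    and norm_eq_zero: "x \<in> alg_carrier A \<Longrightarrow> alg_norm A x = 0 \<longleftrightarrow> x = alg_zero A"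
    and norm_triangle: "\<lbrakk>x \<in> alg_carrier A; y \<in> alg_carrier A\<rbrakk>
      \<Longrightarrow> alg_norm A (alg_add A x y) \<le> alg_norm A x + alg_norm A y"
    and norm_scale: "x \<in> alg_carrier A \<Longrightarrow> alg_norm A (alg_scale A c x) = cmod c * alg_norm A x"
    and norm_mult: "\<lbrakk>x \<in> alg_carrier A; y \<in> alg_carrier A\<rbrakk>
      \<Longrightarrow> alg_norm A (alg_mult A x y) \<le> alg_norm A x * alg_norm A y"
    and complete: "\<lbrakk>\<And>n. X n \<in> alg_carrier A;
        \<And>e. e > 0 \<Longrightarrow> \<exists>N. \<forall>m\<ge>N. \<forall>n\<ge>N. alg_norm A (alg_diff A (X m) (X n)) < e\<rbrakk>
      \<Longrightarrow> \<exists>x\<in>alg_carrier A. (\<lambda>n. alg_norm A (alg_diff A (X n) x)) \<longlonglongrightarrow> 0"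

definition without_order :: "'a complex_alg \<Rightarrow> bool" where
  "without_order A \<longleftrightarrow>
    (\<forall>a\<in>alg_carrier A. (\<forall>b\<in>alg_carrier A. alg_mult A a b = alg_zero A) \<longrightarrow> a = alg_zero A)"


section \<open>Gel'fand theory\<close>

definition spectrum_space :: "'a complex_alg \<Rightarrow> ('a \<Rightarrow> complex) set" where
  "spectrum_space A = {\<phi> \<in> extensional (alg_carrier A).
     (\<forall>a\<in>alg_carrier A. \<forall>b\<in>alg_carrier A. \<phi> (alg_add A a b) = \<phi> a + \<phi> b) \<and>
     (\<forall>c. \<forall>a\<in>alg_carrier A. \<phi> (alg_scale A c a) = c * \<phi> a) \<and>
     (\<forall>a\<in>alg_carrier A. \<forall>b\<in>alg_carrier A. \<phi> (alg_mult A a b) = \<phi> a * \<phi> b) \<and>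
     (\<exists>a\<in>alg_carrier A. \<phi> a \<noteq> 0)}"

definition gelfand :: "'a complex_alg \<Rightarrow> 'a \<Rightarrow> ('a \<Rightarrow> complex) \<Rightarrow> complex" where
  "gelfand A a = (\<lambda>\<phi>\<in>spectrum_space A. \<phi> a)"

definition gelfand_topology :: "'a complex_alg \<Rightarrow> ('a \<Rightarrow> complex) topology" where
  "gelfand_topology A = topology_generated_by
     {{\<phi> \<in> spectrum_space A. gelfand A a \<phi> \<in> U} | a U. a \<in> alg_carrier A \<and> open U}"


section \<open>Multipliers\<close>

definition multipliers :: "'a complex_alg \<Rightarrow> ('a \<Rightarrow> 'a) set" where
  "multipliers A = {T \<in> alg_carrier A \<rightarrow>\<^sub>E alg_carrier A.
     \<forall>a\<in>alg_carrier A. \<forall>b\<in>alg_carrier A.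
       T (alg_mult A a b) = alg_mult A a (T b) \<and> T (alg_mult A a b) = alg_mult A (T a) b}"

definition multiplier_transform ::
  "'a complex_alg \<Rightarrow> ('a \<Rightarrow> 'a) \<Rightarrow> ('a \<Rightarrow> complex) \<Rightarrow> complex" where
  "multiplier_transform A T = (THE \<sigma>. \<sigma> \<in> extensional (spectrum_space A) \<and>
     continuous_map (gelfand_topology A) euclidean \<sigma> \<and>
     bounded (\<sigma> ` spectrum_space A) \<and>
     (\<forall>a\<in>alg_carrier A. \<forall>\<phi>\<in>spectrum_space A. gelfand A (T a) \<phi> = \<sigma> \<phi> * gelfand A a \<phi>))"


section \<open>BSE-algebras\<close>

text \<open>The supremum below is over a bounded set whenever \<open>F\<close> is a linear combination of characters
  of a commutative Banach algebra, because characters are automatically contractive.\<close>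

definition dual_norm :: "'a complex_alg \<Rightarrow> ('a \<Rightarrow> complex) \<Rightarrow> real" where
  "dual_norm A F = (SUP a\<in>{a \<in> alg_carrier A. alg_norm A a \<le> 1}. cmod (F a))"

definition BSE_functions :: "'a complex_alg \<Rightarrow> (('a \<Rightarrow> complex) \<Rightarrow> complex) set" where
  "BSE_functions A = {\<sigma> \<in> extensional (spectrum_space A).
     continuous_map (gelfand_topology A) euclidean \<sigma> \<and>
     (\<exists>C>0. \<forall>(n::nat) \<phi> c. n \<ge> 1 \<longrightarrow> (\<forall>i\<in>{1..n}. \<phi> i \<in> spectrum_space A) \<longrightarrow>
        cmod (\<Sum>i=1..n. c i * \<sigma> (\<phi> i)) \<le> C * dual_norm A (\<lambda>a. \<Sum>i=1..n. c i * \<phi> i a))}"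

definition BSE_algebra :: "'a complex_alg \<Rightarrow> bool" where
  "BSE_algebra A \<longleftrightarrow> comm_banach_algebra A \<and> without_order A \<and>
     BSE_functions A = multiplier_transform A ` multipliers A"


section \<open>Weighted Dirichlet series\<close>

text \<open>The semigroup is \<open>{1..}\<close>; the value of a weight at \<open>0\<close> is irrelevant.
  Coefficient sequences, being indexed by \<open>{1..}\<close>, are extended by \<open>0\<close> at \<open>0\<close>.\<close>

definition weight :: "(nat \<Rightarrow> real) \<Rightarrow> bool" where
  "weight \<omega> \<longleftrightarrow> (\<forall>n\<ge>1. \<omega> n \<ge> 1) \<and> (\<forall>m\<ge>1. \<forall>n\<ge>1. \<omega> (m * n) \<le> \<omega> m * \<omega> n)"

definition l1_carrier :: "(nat \<Rightarrow> real) \<Rightarrow> (nat \<Rightarrow> complex) set" where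
  "l1_carrier \<omega> = {a. a 0 = 0 \<and> (\<lambda>n. cmod (a n) * \<omega> n) summable_on {1..}}"

definition l1_norm :: "(nat \<Rightarrow> real) \<Rightarrow> (nat \<Rightarrow> complex) \<Rightarrow> real" where
  "l1_norm \<omega> a = (\<Sum>\<^sub>\<infinity>n\<in>{1..}. cmod (a n) * \<omega> n)"

definition dirichlet_conv :: "(nat \<Rightarrow> complex) \<Rightarrow> (nat \<Rightarrow> complex) \<Rightarrow> nat \<Rightarrow> complex" where
  "dirichlet_conv f g n = (if n = 0 then 0 else \<Sum>d | d dvd n. f d * g (n div d))"

definition l1_alg :: "(nat \<Rightarrow> real) \<Rightarrow> (nat \<Rightarrow> complex) complex_alg" where
  "l1_alg \<omega> = \<lparr>alg_carrier = l1_carrier \<omega>,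
     alg_zero = (\<lambda>n. 0),
     alg_add = (\<lambda>f g n. f n + g n),
     alg_scale = (\<lambda>c f n. c * f n),
     alg_mult = dirichlet_conv,
     alg_norm = l1_norm \<omega>\<rparr>"

definition half_plane :: "complex set" where
  "half_plane = {s. Re s \<ge> 0}"

definition dirichlet_rep :: "(nat \<Rightarrow> real) \<Rightarrow> (nat \<Rightarrow> complex) \<Rightarrow> (complex \<Rightarrow> complex) \<Rightarrow> bool" where
  "dirichlet_rep \<omega> a f \<longleftrightarrow> a \<in> l1_carrier \<omega> \<and>
     (\<forall>s\<in>half_plane. ((\<lambda>n. a n * of_nat n powr (- s)) has_sum f s) {1..})"

text \<open>The coefficients of a Dirichlet series are unique, so the description below is proper.\<close>

definition dirichlet_alg :: "(nat \<Rightarrow> real) \<Rightarrow> (complex \<Rightarrow> complex) complex_alg" where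
  "dirichlet_alg \<omega> = \<lparr>alg_carrier = {f \<in> extensional half_plane. \<exists>a. dirichlet_rep \<omega> a f},
     alg_zero = (\<lambda>s\<in>half_plane. 0),
     alg_add = (\<lambda>f g. \<lambda>s\<in>half_plane. f s + g s),
     alg_scale = (\<lambda>c f. \<lambda>s\<in>half_plane. c * f s),
     alg_mult = (\<lambda>f g. \<lambda>s\<in>half_plane. f s * g s),
     alg_norm = (\<lambda>f. l1_norm \<omega> (THE a. dirichlet_rep \<omega> a f))\<rparr>"

end

theory Submission
  imports Defs
begin

text \<open>
  A character of \<open>\<ell>\<^sup>1(\<nat>, \<omega>)\<close> is given by a completely multiplicative \<open>\<psi>\<close> with \<open>|\<psi>| \<le> \<omega>\<close>, and a BSE-function
  \<open>\<sigma>\<close> is a linear functional on the span of the characters, bounded in the norm \<open>sup |g n| / \<omega> n\<close>.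
  The unit sequences lie in the closure of this span, already in that of the characters \<open>n\<^sup>-\<^sup>s\<close> with
  \<open>s > 0\<close>. The values \<open>a n\<close> of \<open>\<sigma>\<close> on them satisfy \<open>\<Sum> |a n| \<omega> n < \<infinity>\<close>, and \<open>\<sigma>(\<psi>) = \<Sum> a n \<psi> n\<close>
  whenever \<open>\<psi> / \<omega>\<close> vanishes at infinity. As \<open>\<omega> \<ge> 1\<close>, this applies to \<open>\<psi>(n) n\<^sup>-\<^sup>s\<close> for every character
  \<open>\<psi>\<close> and \<open>s > 0\<close>, and \<open>s \<rightarrow> 0\<close> gives the formula for \<open>\<psi>\<close> by continuity of \<open>\<sigma>\<close>. No Hahn-Banach
  extension or weak-star compactness is needed.
\<close>

section \<open>Dirichlet convolution\<close>

text \<open>The obstacle is that \<open>\<psi> / \<omega>\<close> need not vanish at infinity: for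
  \<open>\<omega> = 1\<close> the sequence constantly 1 on \<open>{1..}\<close> is a character. Such
  a \<open>\<psi>\<close> is not a limit of finitely supported sequences, so values on unit
  sequences do not determine \<open>\<sigma>\<close> there by norm continuity alone. Twisting by
  \<open>n\<^sup>-\<^sup>s\<close> stays inside the characters, forces the decay, and joins
  \<open>\<psi>\<close> to decaying characters by a path that is continuous in the Gel'fand
  topology. Summability of \<open>|a n| \<omega> n\<close> is tested on finite combinations of unit
  sequences whose coefficients cancel the phases of \<open>a n\<close> and have modulus at most
  \<open>\<omega> n\<close>. These have norm at most 1, so the partial sums stay below the BSE
  constant. The extension of \<open>\<sigma>\<close> is handled as a relation; the BSE inequality
  makes it single-valued and survives limits. The approximation of unit sequences also yields
  uniqueness of Dirichlet coefficients, from which commutativity and associativity of the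
  convolution are read off.\<close>

lemma dirichlet_conv_infsum:
  fixes a b :: "nat \<Rightarrow> complex"
  assumes a: "(\<lambda>n. norm (a n)) summable_on {1..}" and b: "(\<lambda>n. norm (b n)) summable_on {1..}"
  shows "(\<lambda>n. norm (dirichlet_conv a b n)) summable_on {1..}"
    and "(\<Sum>\<^sub>\<infinity>n\<in>{1..}. dirichlet_conv a b n) = (\<Sum>\<^sub>\<infinity>n\<in>{1..}. a n) * (\<Sum>\<^sub>\<infinity>n\<in>{1..}. b n)"
proof -
  define f where "f = (\<lambda>(d, e). a d * b e)"
  define D where "D = Sigma {1::nat..} (\<lambda>n. {d. d dvd n})"
  define h where "h = (\<lambda>(n::nat, d). (d, n div d))"
  have sums: "a summable_on {1..}" "b summable_on {1..}"
    using a b by (auto intro: abs_summable_summable)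
  have inner: "(\<lambda>y. norm (f (x, y))) summable_on {1..}" for x
    using summable_on_cmult_right[OF b, of "norm (a x)"] by (simp add: f_def norm_mult)
  have "(\<Sum>\<^sub>\<infinity>y\<in>{1..}. norm (f (x, y))) = norm (a x) * (\<Sum>\<^sub>\<infinity>y\<in>{1..}. norm (b y))" for x
    using infsum_cmult_right[of "norm (a x)" "\<lambda>y. norm (b y)" "{1..}"] b
    by (simp add: f_def norm_mult)
  then have "(\<lambda>x. norm (\<Sum>\<^sub>\<infinity>y\<in>{1..}. norm (f (x, y)))) summable_on {1..}"
    using summable_on_cmult_left[OF a, of "\<Sum>\<^sub>\<infinity>y\<in>{1..}. norm (b y)"]
    by (simp add: abs_mult infsum_nonneg)
  then have abs_f: "(\<lambda>p. norm (f p)) summable_on {1..} \<times> {1..}"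
    unfolding Infinite_Sum.abs_summable_on_Sigma_iff using inner by simp
  have sum_f: "(f has_sum (infsum a {1..} * infsum b {1..})) ({1..} \<times> {1..})"
  proof (rule has_sum_SigmaI)
    show "((\<lambda>y. f (x, y)) has_sum a x * infsum b {1..}) {1..}" for x
      using has_sum_cmult_right[OF has_sum_infsum[OF sums(2)], of "a x"] by (simp add: f_def)
    show "((\<lambda>x. a x * infsum b {1..}) has_sum infsum a {1..} * infsum b {1..}) {1..}"
      by (rule has_sum_cmult_left[OF has_sum_infsum[OF sums(1)]])
    show "f summable_on {1..} \<times> {1..}"
      using abs_f by (rule abs_summable_summable)
  qed
  \<comment> \<open>Divisor pairs \<open>(n, d)\<close> correspond to factorisations
    \<open>(d, e)\<close> with \<open>n = d * e\<close>. Summing the absolutely summable double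
    family along \<open>n\<close> first gives the convolution, along the two factors the
    product.\<close>
  have bij: "bij_betw h D ({1..} \<times> {1..})"
    by (rule bij_betw_byWitness[where f' = "\<lambda>(d, e). (d * e, d)"])
      (auto simp: h_def D_def Suc_le_eq dest: dvd_pos_nat intro: Nat.gr0I elim!: dvdE)
  have sum_h: "((\<lambda>p. f (h p)) has_sum (infsum a {1..} * infsum b {1..})) D"
    using has_sum_reindex_bij_betw[OF bij] sum_f by blast
  have abs_h: "(\<lambda>p. norm (f (h p))) summable_on D"
    using summable_on_reindex_bij_betw[OF bij, of "\<lambda>p. norm (f p)"] abs_f by simp
  have conv: "dirichlet_conv a b n = (\<Sum>d | d dvd n. f (h (n, d)))" if "n \<ge> 1" for n
    using that by (simp add: dirichlet_conv_def f_def h_def)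
  have "(\<lambda>n. \<Sum>\<^sub>\<infinity>d | d dvd n. norm (f (h (n, d)))) summable_on {1..}"
    using abs_h unfolding D_def Infinite_Sum.abs_summable_on_Sigma_iff
    by (simp add: abs_of_nonneg infsum_nonneg)
  then show "(\<lambda>n. norm (dirichlet_conv a b n)) summable_on {1..}"
  proof (rule Infinite_Sum.abs_summable_on_comparison_test')
    fix n :: nat assume "n \<in> {1..}"
    then show "norm (dirichlet_conv a b n) \<le> (\<Sum>\<^sub>\<infinity>d | d dvd n. norm (f (h (n, d))))"
      by (simp add: conv sum_norm_le)
  qed
  have "(dirichlet_conv a b has_sum (infsum a {1..} * infsum b {1..})) {1..}"
    using sum_h unfolding D_def
    by (rule has_sum_SigmaD) (auto intro!: has_sum_finiteI simp: conv)
  then show "infsum (dirichlet_conv a b) {1..} = infsum a {1..} * infsum b {1..}"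
    by (rule infsumI)
qed

lemma dirichlet_conv_diff_right:
  "dirichlet_conv a (\<lambda>n. b n - c n) n = dirichlet_conv a b n - dirichlet_conv a c n"
  by (simp add: dirichlet_conv_def algebra_simps sum_subtractf)

text \<open>Because \<open>\<psi> n\<close> splits along every factorisation of \<open>n\<close>,
  twisting by \<open>\<psi>\<close> respects convolution. This reduces multiplicativity of the
  pairing to the product formula for plain sums.\<close>

lemma dirichlet_conv_twist:
  assumes "\<And>m n. m \<ge> 1 \<Longrightarrow> n \<ge> 1 \<Longrightarrow> \<psi> (m * n) = \<psi> m * \<psi> n"
  shows "dirichlet_conv a b n * \<psi> n = dirichlet_conv (\<lambda>n. a n * \<psi> n) (\<lambda>n. b n * \<psi> n) n"
proof (cases "n = 0")
  case False
  have split: "\<psi> n = \<psi> d * \<psi> (n div d)" if "d dvd n" for d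
    using that assms[of d "n div d"] False by (fastforce elim!: dvdE simp: Suc_le_eq)
  have "dirichlet_conv a b n * \<psi> n = (\<Sum>d | d dvd n. a d * b (n div d) * \<psi> n)"
    using False by (simp add: dirichlet_conv_def sum_distrib_right)
  also have "\<dots> = (\<Sum>d | d dvd n. (a d * \<psi> d) * (b (n div d) * \<psi> (n div d)))"
    by (intro sum.cong refl) (simp add: split mult_ac)
  finally show ?thesis
    using False by (simp add: dirichlet_conv_def)
qed (simp add: dirichlet_conv_def)

section \<open>The weighted sequence space\<close>

text \<open>The bilinear duality, without conjugation, between weighted summable sequences and
  sequences bounded by a multiple of \<open>\<omega>\<close>; for a character sequence
  \<open>\<psi>\<close> it is the Gel'fand transform.\<close>

definition pairing :: "(nat \<Rightarrow> complex) \<Rightarrow> (nat \<Rightarrow> complex) \<Rightarrow> complex" where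
  "pairing a \<psi> = (\<Sum>\<^sub>\<infinity>n\<in>{1..}. a n * \<psi> n)"

definition unit_seq :: "nat \<Rightarrow> nat \<Rightarrow> complex" where
  "unit_seq k n = (if n = k then 1 else 0)"

text \<open>As \<open>0 powr x = 0\<close>, the value at index 0 is 0 for every \<open>s\<close>,
  including \<open>s = 0\<close>, in agreement with the normalisation of character
  sequences.\<close>

definition npow :: "real \<Rightarrow> nat \<Rightarrow> complex" where
  "npow s n = of_real (real n powr - s)"

lemma npow_mult: "npow s (m * n) = npow s m * npow s n"
  by (simp add: npow_def powr_mult)

lemma norm_npow_le_1:
  assumes "s \<ge> 0" "n \<ge> 1"
  shows "cmod (npow s n) \<le> 1"
proof -
  have "real n powr - s \<le> 1"
    using assms by (simp add: powr_minus ge_one_powr_ge_zero inverse_le_1_iff)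
  then show ?thesis by (simp add: npow_def)
qed

locale weighted_l1 =
  fixes \<omega> :: "nat \<Rightarrow> real"
  assumes weight: "weight \<omega>"
begin

lemma weight_ge_1: "n \<ge> 1 \<Longrightarrow> \<omega> n \<ge> 1"
  using weight by (simp add: weight_def)

lemma weight_mult: "m \<ge> 1 \<Longrightarrow> n \<ge> 1 \<Longrightarrow> \<omega> (m * n) \<le> \<omega> m * \<omega> n"
  using weight by (simp add: weight_def)

lemma weighted_nonneg: "n \<in> {1..} \<Longrightarrow> 0 \<le> cmod (a n) * \<omega> n"
  using weight_ge_1[of n] by simp

lemma l1_summable: "a \<in> l1_carrier \<omega> \<Longrightarrow> (\<lambda>n. cmod (a n) * \<omega> n) summable_on {1..}"
  by (simp add: l1_carrier_def)

lemma l1_norm_nonneg: "0 \<le> l1_norm \<omega> a"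
  unfolding l1_norm_def by (rule infsum_nonneg) (rule weighted_nonneg)

lemma l1_boundedI:
  assumes "a 0 = 0" and "\<And>F. finite F \<Longrightarrow> F \<subseteq> {1..} \<Longrightarrow> (\<Sum>n\<in>F. cmod (a n) * \<omega> n) \<le> B"
  shows "a \<in> l1_carrier \<omega>" and "l1_norm \<omega> a \<le> B"
proof -
  have sum: "(\<lambda>n. cmod (a n) * \<omega> n) summable_on {1..}"
    by (rule nonneg_bdd_above_summable_on)
      (auto intro!: bdd_aboveI2[where M = B] assms(2) weighted_nonneg)
  then show "a \<in> l1_carrier \<omega>"
    using assms(1) by (simp add: l1_carrier_def)
  show "l1_norm \<omega> a \<le> B"
    unfolding l1_norm_def by (rule infsum_le_finite_sums[OF sum assms(2)])
qed

lemma l1_finite_le: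
  assumes "a \<in> l1_carrier \<omega>" "finite F" "F \<subseteq> {1..}"
  shows "(\<Sum>n\<in>F. cmod (a n) * \<omega> n) \<le> l1_norm \<omega> a"
  unfolding l1_norm_def using assms
  by (intro finite_sum_le_infsum l1_summable) (auto intro: weighted_nonneg)

lemma l1_coeff_le:
  assumes "a \<in> l1_carrier \<omega>"
  shows "cmod (a n) \<le> l1_norm \<omega> a"
proof (cases "n \<ge> 1")
  case True
  then have "cmod (a n) \<le> cmod (a n) * \<omega> n"
    using weight_ge_1[of n] by (simp add: mult_le_cancel_left1)
  also have "\<dots> \<le> l1_norm \<omega> a"
    using l1_finite_le[OF assms, of "{n}"] True by simp
  finally show ?thesis .
next
  case False
  then show ?thesis
    using assms l1_norm_nonneg by (simp add: l1_carrier_def not_le)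
qed

lemma l1_add:
  assumes "a \<in> l1_carrier \<omega>" "b \<in> l1_carrier \<omega>"
  shows "(\<lambda>n. a n + b n) \<in> l1_carrier \<omega>"
    and "l1_norm \<omega> (\<lambda>n. a n + b n) \<le> l1_norm \<omega> a + l1_norm \<omega> b"
proof -
  have "(\<Sum>n\<in>F. cmod (a n + b n) * \<omega> n) \<le> l1_norm \<omega> a + l1_norm \<omega> b"
    if F: "finite F" "F \<subseteq> {1..}" for F
  proof -
    have "(\<Sum>n\<in>F. cmod (a n + b n) * \<omega> n) \<le> (\<Sum>n\<in>F. cmod (a n) * \<omega> n + cmod (b n) * \<omega> n)"
    proof (rule sum_mono)
      fix n assume "n \<in> F"
      then have "\<omega> n \<ge> 0"
        using F(2) weight_ge_1[of n] by force
      then show "cmod (a n + b n) * \<omega> n \<le> cmod (a n) * \<omega> n + cmod (b n) * \<omega> n"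
        using mult_right_mono[OF norm_triangle_ineq] by (simp add: distrib_right[symmetric])
    qed
    also have "\<dots> \<le> l1_norm \<omega> a + l1_norm \<omega> b"
      using F l1_finite_le assms by (simp add: sum.distrib add_mono)
    finally show ?thesis .
  qed
  moreover have "a 0 + b 0 = 0"
    using assms by (simp add: l1_carrier_def)
  ultimately show "(\<lambda>n. a n + b n) \<in> l1_carrier \<omega>"
    "l1_norm \<omega> (\<lambda>n. a n + b n) \<le> l1_norm \<omega> a + l1_norm \<omega> b"
    using l1_boundedI[of "\<lambda>n. a n + b n"] by auto
qed

lemma l1_scale:
  assumes "a \<in> l1_carrier \<omega>"
  shows "(\<lambda>n. c * a n) \<in> l1_carrier \<omega>"
    and "l1_norm \<omega> (\<lambda>n. c * a n) = cmod c * l1_norm \<omega> a"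
  using assms summable_on_cmult_right[OF l1_summable[OF assms], of "cmod c"]
    infsum_cmult_right[OF l1_summable[OF assms], of "cmod c"]
  by (auto simp: l1_carrier_def l1_norm_def norm_mult mult.assoc)

lemma l1_diff:
  assumes "a \<in> l1_carrier \<omega>" "b \<in> l1_carrier \<omega>"
  shows "(\<lambda>n. a n - b n) \<in> l1_carrier \<omega>"
    and "l1_norm \<omega> (\<lambda>n. a n - b n) \<le> l1_norm \<omega> a + l1_norm \<omega> b"
  using l1_add[OF assms(1) l1_scale(1)[OF assms(2), of "-1"]] l1_scale(2)[OF assms(2), of "-1"]
  by auto

lemma l1_zero: "(\<lambda>n. 0) \<in> l1_carrier \<omega>" "l1_norm \<omega> (\<lambda>n. 0) = 0"
  by (auto simp: l1_carrier_def l1_norm_def)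

lemma l1_norm_eq_0_iff:
  assumes "a \<in> l1_carrier \<omega>"
  shows "l1_norm \<omega> a = 0 \<longleftrightarrow> a = (\<lambda>n. 0)"
  using l1_coeff_le[OF assms] l1_zero(2) by force

text \<open>Submultiplicativity of \<open>\<omega>\<close> bounds the weighted modulus of the
  convolution, term by term, by the convolution of the weighted moduli, and the latter sums to the
  product of the norms.\<close>

lemma l1_conv:
  assumes "a \<in> l1_carrier \<omega>" "b \<in> l1_carrier \<omega>"
  shows "dirichlet_conv a b \<in> l1_carrier \<omega>"
    and "l1_norm \<omega> (dirichlet_conv a b) \<le> l1_norm \<omega> a * l1_norm \<omega> b"
proof -
  \<comment> \<open>The weighted moduli are viewed as complex sequences to suit
    \<open>dirichlet_conv_infsum\<close>; \<open>has_sum_of_real_iff\<close> later returns to the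
    reals.\<close>
  define a' b' where "a' = (\<lambda>n. complex_of_real (cmod (a n) * \<omega> n))"
    and "b' = (\<lambda>n. complex_of_real (cmod (b n) * \<omega> n))"
  define c where "c n = (\<Sum>d | d dvd n. (cmod (a d) * \<omega> d) * (cmod (b (n div d)) * \<omega> (n div d)))" for n
  have norms: "cmod (a' n) = cmod (a n) * \<omega> n" "cmod (b' n) = cmod (b n) * \<omega> n" if "n \<ge> 1" for n
    using that weight_ge_1[of n] by (auto simp: a'_def b'_def norm_mult)
  have abs: "(\<lambda>n. norm (a' n)) summable_on {1..}" "(\<lambda>n. norm (b' n)) summable_on {1..}"
    using assms[THEN l1_summable] norms
      summable_on_cong[of "{1..}" "\<lambda>n. cmod (a' n)" "\<lambda>n. cmod (a n) * \<omega> n"]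
      summable_on_cong[of "{1..}" "\<lambda>n. cmod (b' n)" "\<lambda>n. cmod (b n) * \<omega> n"] by simp_all
  have c: "dirichlet_conv a' b' n = of_real (c n)" if "n \<ge> 1" for n
    using that by (simp add: dirichlet_conv_def c_def a'_def b'_def)
  have factor: "\<omega> n \<le> \<omega> d * \<omega> (n div d)" "d \<ge> 1" "n div d \<ge> 1" if "n \<ge> 1" "d dvd n" for n d
    proof -
    have "d * (n div d) = n" "d \<noteq> 0" "n div d \<noteq> 0"
      using that by auto
    then show "d \<ge> 1" "n div d \<ge> 1" "\<omega> n \<le> \<omega> d * \<omega> (n div d)"
      using weight_mult[of d "n div d"] by auto
  qed
  have c_nonneg: "c n \<ge> 0" if "n \<ge> 1" for n
    unfolding c_def using that factor
    by (intro sum_nonneg mult_nonneg_nonneg weighted_nonneg) auto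
  have le: "cmod (dirichlet_conv a b n) * \<omega> n \<le> c n" if n: "n \<ge> 1" for n
  proof -
    have "cmod (dirichlet_conv a b n) * \<omega> n \<le> (\<Sum>d | d dvd n. cmod (a d) * cmod (b (n div d))) * \<omega> n"
      using n weight_ge_1[of n]
      by (intro mult_right_mono) (auto simp: dirichlet_conv_def norm_mult intro!: sum_norm_le)
    also have "\<dots> \<le> c n"
      unfolding c_def sum_distrib_right
    proof (rule sum_mono)
      fix d assume "d \<in> {d. d dvd n}"
      then have "cmod (a d) * cmod (b (n div d)) * \<omega> n
          \<le> cmod (a d) * cmod (b (n div d)) * (\<omega> d * \<omega> (n div d))"
        using factor n by (intro mult_left_mono) auto
      then show "cmod (a d) * cmod (b (n div d)) * \<omega> n
          \<le> cmod (a d) * \<omega> d * (cmod (b (n div d)) * \<omega> (n div d))"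
        by (simp add: ac_simps)
    qed
    finally show ?thesis .
  qed
  have "((\<lambda>n. complex_of_real (c n)) has_sum infsum (dirichlet_conv a' b') {1..}) {1..}"
    using has_sum_infsum[OF abs_summable_summable[OF dirichlet_conv_infsum(1)[OF abs]]]
      has_sum_cong[of "{1..}" "dirichlet_conv a' b'" "\<lambda>n. of_real (c n)"] c by simp
  moreover have "infsum a' {1..} = of_real (l1_norm \<omega> a)" "infsum b' {1..} = of_real (l1_norm \<omega> b)"
    using has_sum_of_real[OF has_sum_infsum[OF l1_summable]] assms
    unfolding l1_norm_def a'_def b'_def by (auto intro: infsumI)
  ultimately have "((\<lambda>n. complex_of_real (c n)) has_sum
      complex_of_real (l1_norm \<omega> a * l1_norm \<omega> b)) {1..}"
    using dirichlet_conv_infsum(2)[OF abs] by simp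
  then have has: "(c has_sum (l1_norm \<omega> a * l1_norm \<omega> b)) {1..}"
    by (simp only: has_sum_of_real_iff)
  have bound: "(\<Sum>n\<in>F. cmod (dirichlet_conv a b n) * \<omega> n) \<le> l1_norm \<omega> a * l1_norm \<omega> b"
    if "finite F" "F \<subseteq> {1..}" for F
  proof -
    have "(\<Sum>n\<in>F. cmod (dirichlet_conv a b n) * \<omega> n) \<le> (\<Sum>n\<in>F. c n)"
      using that le by (intro sum_mono) auto
    also have "\<dots> \<le> l1_norm \<omega> a * l1_norm \<omega> b"
      using that by (intro finite_sum_le_has_sum[OF has]) (auto simp: c_nonneg)
    finally show ?thesis .
  qed
  show "dirichlet_conv a b \<in> l1_carrier \<omega>"
    "l1_norm \<omega> (dirichlet_conv a b) \<le> l1_norm \<omega> a * l1_norm \<omega> b"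
    by (rule l1_boundedI[OF _ bound]; simp add: dirichlet_conv_def)+
qed

section \<open>Completeness and the geometric series\<close>

lemma l1_complete:
  assumes X: "\<And>n. X n \<in> l1_carrier \<omega>"
    and Cauchy: "\<And>e. e > 0 \<Longrightarrow> \<exists>N. \<forall>m\<ge>N. \<forall>n\<ge>N. l1_norm \<omega> (\<lambda>k. X m k - X n k) < e"
  shows "\<exists>x\<in>l1_carrier \<omega>. (\<lambda>n. l1_norm \<omega> (\<lambda>k. X n k - x k)) \<longlonglongrightarrow> 0"
proof -
  have "Cauchy (\<lambda>n. X n k)" for k
  proof (rule metric_CauchyI)
    fix e :: real assume "e > 0"
    then obtain N where "\<forall>m\<ge>N. \<forall>n\<ge>N. l1_norm \<omega> (\<lambda>k. X m k - X n k) < e"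
      using Cauchy by blast
    moreover have "dist (X m k) (X n k) \<le> l1_norm \<omega> (\<lambda>k. X m k - X n k)" for m n
      using l1_coeff_le[OF l1_diff(1)[OF X[of m] X[of n]], of k] by (simp add: dist_norm)
    ultimately show "\<exists>N. \<forall>m\<ge>N. \<forall>n\<ge>N. dist (X m k) (X n k) < e"
      by (meson le_less_trans)
  qed
  then have "\<exists>l. (\<lambda>n. X n k) \<longlonglongrightarrow> l" for k
    by (simp add: Cauchy_convergent_iff convergent_def)
  then obtain x where x: "\<And>k. (\<lambda>n. X n k) \<longlonglongrightarrow> x k"
    by metis
  have x0: "x 0 = 0"
    using x[of 0] X by (simp add: l1_carrier_def LIMSEQ_const_iff)
  have tail: "\<exists>N. \<forall>m\<ge>N. (\<lambda>k. X m k - x k) \<in> l1_carrier \<omega> \<and> l1_norm \<omega> (\<lambda>k. X m k - x k) \<le> e"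
    \<comment> \<open>The Cauchy estimate holds on every finite index set, where the limit in
      \<open>n\<close> may be taken coefficientwise; \<open>l1_boundedI\<close> then removes the
      finiteness.\<close>
    if "e > 0" for e
  proof -
    obtain N where N: "\<And>m n. m \<ge> N \<Longrightarrow> n \<ge> N \<Longrightarrow> l1_norm \<omega> (\<lambda>k. X m k - X n k) < e"
      using Cauchy[OF \<open>e > 0\<close>] by blast
    have "(\<Sum>k\<in>F. cmod (X m k - x k) * \<omega> k) \<le> e" if m: "m \<ge> N" and F: "finite F" "F \<subseteq> {1..}" for m F
    proof (rule LIMSEQ_le_const2)
      show "(\<lambda>n. \<Sum>k\<in>F. cmod (X m k - X n k) * \<omega> k) \<longlonglongrightarrow> (\<Sum>k\<in>F. cmod (X m k - x k) * \<omega> k)"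
        by (intro tendsto_intros x)
      show "\<exists>N. \<forall>n\<ge>N. (\<Sum>k\<in>F. cmod (X m k - X n k) * \<omega> k) \<le> e"
        using l1_finite_le[OF l1_diff(1)[OF X[of m] X] F] N[OF m] by (meson less_imp_le order_trans)
    qed
    then have "\<forall>m\<ge>N. (\<lambda>k. X m k - x k) \<in> l1_carrier \<omega> \<and> l1_norm \<omega> (\<lambda>k. X m k - x k) \<le> e"
      using l1_boundedI[of "\<lambda>k. X _ k - x k" e] x0 X by (simp add: l1_carrier_def)
    then show ?thesis ..
  qed
  obtain N where "(\<lambda>k. X N k - x k) \<in> l1_carrier \<omega>"
    using tail[of 1] by auto
  then have "x \<in> l1_carrier \<omega>"
    using l1_diff(1)[OF X[of N]] by fastforce
  moreover have "(\<lambda>n. l1_norm \<omega> (\<lambda>k. X n k - x k)) \<longlonglongrightarrow> 0"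
  proof (rule LIMSEQ_I)
    fix r :: real assume "r > 0"
    then obtain N where N: "\<forall>m\<ge>N. l1_norm \<omega> (\<lambda>k. X m k - x k) \<le> r / 2"
      using tail[of "r / 2"] by auto
    have "norm (l1_norm \<omega> (\<lambda>k. X n k - x k) - 0) < r" if "n \<ge> N" for n
      using N[rule_format, OF that] \<open>r > 0\<close> l1_norm_nonneg[of "\<lambda>k. X n k - x k"] by simp
    then show "\<exists>N. \<forall>n\<ge>N. norm (l1_norm \<omega> (\<lambda>k. X n k - x k) - 0) < r"
      by blast
  qed
  ultimately show ?thesis by blast
qed

text \<open>The solution is the quasi-inverse \<open>b + b\<^sup>2 + b\<^sup>3 + \<dots>\<close>,
  obtained as the fixed point of a map that contracts distances by the factor
  \<open>l1_norm \<omega> b\<close>. It is what makes characters automatically contractive.\<close>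

lemma l1_geometric_series:
  assumes b: "b \<in> l1_carrier \<omega>" and less: "l1_norm \<omega> b < 1"
  shows "\<exists>c\<in>l1_carrier \<omega>. c = (\<lambda>n. b n + dirichlet_conv b c n)"
proof -
  define r where "r = l1_norm \<omega> b"
  define T where "T c = (\<lambda>n. b n + dirichlet_conv b c n)" for c
  define S where "S k = (T ^^ k) (\<lambda>n. 0)" for k
  have r: "0 \<le> r" "r < 1"
    using less l1_norm_nonneg by (auto simp: r_def)
  have T: "T c \<in> l1_carrier \<omega>" if "c \<in> l1_carrier \<omega>" for c
    unfolding T_def using that by (intro l1_add l1_conv b)
  have T_diff: "l1_norm \<omega> (\<lambda>n. T c n - T d n) \<le> r * l1_norm \<omega> (\<lambda>n. c n - d n)"
    if "c \<in> l1_carrier \<omega>" "d \<in> l1_carrier \<omega>" for c d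
    using l1_conv(2)[OF b l1_diff(1)[OF that]]
    by (simp add: T_def r_def dirichlet_conv_diff_right[abs_def])
  have S: "S k \<in> l1_carrier \<omega>" for k
    by (induction k) (auto simp: S_def l1_zero T)
  have SS: "S (Suc k) = T (S k)" for k
    by (simp add: S_def)
  have "l1_norm \<omega> (\<lambda>n. S (k + j) n - S k n) \<le> r ^ k / (1 - r)" for j k
  proof (induction k)
    case 0
    have "l1_norm \<omega> (S j) \<le> 1 / (1 - r)"
    proof (induction j)
      case 0
      then show ?case using r by (simp add: S_def l1_zero)
    next
      case (Suc j)
      have "l1_norm \<omega> (S (Suc j)) \<le> r + r * l1_norm \<omega> (S j)"
        using l1_add(2)[OF b l1_conv(1)[OF b S[of j]]] l1_conv(2)[OF b S[of j]]
        by (simp add: SS T_def r_def)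
      also have "\<dots> \<le> r + r * (1 / (1 - r))"
        using Suc r by (intro add_left_mono mult_left_mono)
      \<comment> \<open>The right side exceeds the left by \<open>1 - r\<close>; with both
        denominators cleared the difference becomes \<open>(1 - r) ^ 3\<close>.\<close>
      also have "\<dots> \<le> 1 / (1 - r)"
        using r zero_le_power[of "1 - r" 3] by (simp add: field_simps power3_eq_cube)
      finally show ?case .
    qed
    then show ?case by (simp add: S_def)
  next
    case (Suc k)
    have "l1_norm \<omega> (\<lambda>n. S (Suc k + j) n - S (Suc k) n) \<le> r * l1_norm \<omega> (\<lambda>n. S (k + j) n - S k n)"
      using T_diff[OF S[of "k + j"] S[of k]] by (simp add: SS)
    also have "\<dots> \<le> r * (r ^ k / (1 - r))"
      using Suc r by (intro mult_left_mono)
    finally show ?case by simp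
  qed
  then have close: "l1_norm \<omega> (\<lambda>n. S (k + j) n - S k n) \<le> r ^ k / (1 - r)" for j k .
  have Cauchy: "\<exists>N. \<forall>m\<ge>N. \<forall>n\<ge>N. l1_norm \<omega> (\<lambda>i. S m i - S n i) < e" if "e > 0" for e
  proof -
    have "(\<lambda>k. r ^ k / (1 - r)) \<longlonglongrightarrow> 0 / (1 - r)"
      using r by (intro tendsto_divide tendsto_const LIMSEQ_power_zero) auto
    then have "eventually (\<lambda>k. r ^ k / (1 - r) < e / 2) sequentially"
      using that by (intro order_tendstoD(2)) auto
    then obtain N where N: "r ^ N / (1 - r) < e / 2"
      by (auto simp: eventually_sequentially)
    have "l1_norm \<omega> (\<lambda>i. S m i - S n i) < e" if "m \<ge> N" "n \<ge> N" for m n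
    proof -
      obtain i j where "m = N + i" "n = N + j"
        using \<open>m \<ge> N\<close> \<open>n \<ge> N\<close> by (auto simp: le_iff_add)
      have "l1_norm \<omega> (\<lambda>i. S m i - S n i)
          \<le> l1_norm \<omega> (\<lambda>i. S m i - S N i) + l1_norm \<omega> (\<lambda>i. S n i - S N i)"
        using l1_diff(2)[OF l1_diff(1)[OF S[of m] S[of N]] l1_diff(1)[OF S[of n] S[of N]]] by simp
      also have "\<dots> < e / 2 + e / 2"
        using le_less_trans[OF close N] \<open>m = N + i\<close> \<open>n = N + j\<close> by (intro add_strict_mono) auto
      finally show ?thesis by simp
    qed
    then show ?thesis by blast
  qed
  obtain c where c: "c \<in> l1_carrier \<omega>" and lim: "(\<lambda>k. l1_norm \<omega> (\<lambda>n. S k n - c n)) \<longlonglongrightarrow> 0"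
    using l1_complete[OF S Cauchy] by blast
  have "l1_norm \<omega> (\<lambda>n. T c n - c n) \<le> 0"
  proof (rule LIMSEQ_le_const)
    show "(\<lambda>k. l1_norm \<omega> (\<lambda>n. S (Suc k) n - c n) + r * l1_norm \<omega> (\<lambda>n. S k n - c n)) \<longlonglongrightarrow> 0"
      using tendsto_add[OF LIMSEQ_Suc[OF lim] tendsto_mult_left[OF lim, of r]] by simp
    \<comment> \<open>Insert \<open>S (Suc k) = T (S k)\<close> between \<open>T c\<close> and
      \<open>c\<close>: one distance tends to 0, the other is contracted from
      \<open>S k - c\<close>.\<close>
    have "l1_norm \<omega> (\<lambda>n. T c n - c n)
        \<le> l1_norm \<omega> (\<lambda>n. S (Suc k) n - c n) + r * l1_norm \<omega> (\<lambda>n. S k n - c n)" for k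
      using l1_diff(2)[OF l1_diff(1)[OF S[of "Suc k"] c] l1_diff(1)[OF S[of "Suc k"] T[OF c]]]
        T_diff[OF S[of k] c] by (simp add: SS)
    then show "\<exists>N. \<forall>k\<ge>N. l1_norm \<omega> (\<lambda>n. T c n - c n)
        \<le> l1_norm \<omega> (\<lambda>n. S (Suc k) n - c n) + r * l1_norm \<omega> (\<lambda>n. S k n - c n)"
      by blast
  qed
  then have "(\<lambda>n. T c n - c n) = (\<lambda>n. 0)"
    using l1_norm_eq_0_iff[OF l1_diff(1)[OF T[OF c] c]] l1_norm_nonneg by (simp add: order_antisym)
  then have "c = T c"
    by (simp add: fun_eq_iff)
  then show ?thesis
    using c unfolding T_def by blast
qed

section \<open>The pairing with sequences bounded by a multiple of the weight\<close>

lemma pairing_summable: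
  assumes a: "a \<in> l1_carrier \<omega>" and \<psi>: "\<And>n. n \<ge> 1 \<Longrightarrow> cmod (\<psi> n) \<le> K * \<omega> n"
  shows "(\<lambda>n. cmod (a n * \<psi> n)) summable_on {1..}" and "(\<lambda>n. a n * \<psi> n) summable_on {1..}"
    and "cmod (pairing a \<psi>) \<le> K * l1_norm \<omega> a"
proof -
  have le: "cmod (a n * \<psi> n) \<le> K * (cmod (a n) * \<omega> n)" if "n \<in> {1..}" for n
    using mult_left_mono[OF \<psi>[of n], of "cmod (a n)"] that by (simp add: norm_mult mult_ac)
  have sum: "(\<lambda>n. K * (cmod (a n) * \<omega> n)) summable_on {1..}"
    by (intro summable_on_cmult_right l1_summable a)
  show abs: "(\<lambda>n. cmod (a n * \<psi> n)) summable_on {1..}"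
    by (rule Infinite_Sum.abs_summable_on_comparison_test'[OF sum le])
  then show "(\<lambda>n. a n * \<psi> n) summable_on {1..}"
    by (rule abs_summable_summable)
  have "cmod (pairing a \<psi>) \<le> (\<Sum>\<^sub>\<infinity>n\<in>{1..}. cmod (a n * \<psi> n))"
    unfolding pairing_def by (rule norm_infsum_bound[OF abs])
  also have "\<dots> \<le> (\<Sum>\<^sub>\<infinity>n\<in>{1..}. K * (cmod (a n) * \<omega> n))"
    by (rule infsum_mono[OF abs sum le])
  also have "\<dots> = K * l1_norm \<omega> a"
    unfolding l1_norm_def by (rule infsum_cmult_right) (rule l1_summable[OF a])
  finally show "cmod (pairing a \<psi>) \<le> K * l1_norm \<omega> a" .
qed

lemma pairing_scale_left: "pairing (\<lambda>n. c * a n) \<psi> = c * pairing a \<psi>"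
  by (simp add: pairing_def mult.assoc infsum_cmult_right')

lemma pairing_scale_right: "pairing a (\<lambda>n. c * \<psi> n) = c * pairing a \<psi>"
  by (simp add: pairing_def mult.left_commute[of _ c] infsum_cmult_right')

lemma pairing_add_left:
  assumes "a \<in> l1_carrier \<omega>" "b \<in> l1_carrier \<omega>" "\<And>n. n \<ge> 1 \<Longrightarrow> cmod (\<psi> n) \<le> K * \<omega> n"
  shows "pairing (\<lambda>n. a n + b n) \<psi> = pairing a \<psi> + pairing b \<psi>"
  using infsum_add[OF pairing_summable(2)[OF assms(1,3)] pairing_summable(2)[OF assms(2,3)]]
  by (simp add: pairing_def distrib_right)

lemma pairing_diff_left:
  assumes "a \<in> l1_carrier \<omega>" "b \<in> l1_carrier \<omega>" "\<And>n. n \<ge> 1 \<Longrightarrow> cmod (\<psi> n) \<le> K * \<omega> n"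
  shows "pairing (\<lambda>n. a n - b n) \<psi> = pairing a \<psi> - pairing b \<psi>"
  using pairing_add_left[OF assms(1) l1_scale(1)[OF assms(2), of "-1"] assms(3)]
    pairing_scale_left[of "-1" b \<psi>] by simp

lemma pairing_add_right:
  assumes "a \<in> l1_carrier \<omega>" "\<And>n. n \<ge> 1 \<Longrightarrow> cmod (\<psi> n) \<le> K * \<omega> n"
    "\<And>n. n \<ge> 1 \<Longrightarrow> cmod (\<theta> n) \<le> L * \<omega> n"
  shows "pairing a (\<lambda>n. \<psi> n + \<theta> n) = pairing a \<psi> + pairing a \<theta>"
  using infsum_add[OF pairing_summable(2)[OF assms(1,2)] pairing_summable(2)[OF assms(1,3)]]
  by (simp add: pairing_def distrib_left)

lemma pairing_unit_seq_left: "k \<ge> 1 \<Longrightarrow> pairing (unit_seq k) \<psi> = \<psi> k"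
  unfolding pairing_def
  by (subst infsum_cong_neutral[where T = "{k}" and g = "\<lambda>n. unit_seq k n * \<psi> n"])
    (auto simp: unit_seq_def)

lemma pairing_unit_seq_right: "k \<ge> 1 \<Longrightarrow> pairing a (unit_seq k) = a k"
  unfolding pairing_def
  by (subst infsum_cong_neutral[where T = "{k}" and g = "\<lambda>n. a n * unit_seq k n"])
    (auto simp: unit_seq_def)

lemma pairing_conv:
  assumes a: "a \<in> l1_carrier \<omega>" and b: "b \<in> l1_carrier \<omega>"
    and mult: "\<And>m n. m \<ge> 1 \<Longrightarrow> n \<ge> 1 \<Longrightarrow> \<psi> (m * n) = \<psi> m * \<psi> n"
    and bound: "\<And>n. n \<ge> 1 \<Longrightarrow> cmod (\<psi> n) \<le> K * \<omega> n"
  shows "pairing (dirichlet_conv a b) \<psi> = pairing a \<psi> * pairing b \<psi>"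
proof -
  have "pairing (dirichlet_conv a b) \<psi>
      = (\<Sum>\<^sub>\<infinity>n\<in>{1..}. dirichlet_conv (\<lambda>n. a n * \<psi> n) (\<lambda>n. b n * \<psi> n) n)"
    unfolding pairing_def by (intro infsum_cong dirichlet_conv_twist mult)
  also have "\<dots> = pairing a \<psi> * pairing b \<psi>"
    unfolding pairing_def 
    by (intro dirichlet_conv_infsum(2) pairing_summable(1)[OF a bound] pairing_summable(1)[OF b bound])
  finally show ?thesis .
qed

lemma unit_seq_in_l1: "k \<ge> 1 \<Longrightarrow> unit_seq k \<in> l1_carrier \<omega>"
  and l1_norm_unit_seq: "k \<ge> 1 \<Longrightarrow> l1_norm \<omega> (unit_seq k) = \<omega> k"
proof -
  assume k: "k \<ge> 1"
  have "((\<lambda>n. cmod (unit_seq k n) * \<omega> n) has_sum \<omega> k) {k}"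
    by (rule has_sum_finiteI) (auto simp: unit_seq_def)
  also have "?this \<longleftrightarrow> ((\<lambda>n. cmod (unit_seq k n) * \<omega> n) has_sum \<omega> k) {1..}"
    using k by (intro has_sum_cong_neutral) (auto simp: unit_seq_def)
  finally have "((\<lambda>n. cmod (unit_seq k n) * \<omega> n) has_sum \<omega> k) {1..}" .
  then show "unit_seq k \<in> l1_carrier \<omega>" "l1_norm \<omega> (unit_seq k) = \<omega> k"
    using k by (auto simp: l1_carrier_def l1_norm_def unit_seq_def has_sum_iff)
qed

lemma npow_bound: "s \<ge> 0 \<Longrightarrow> n \<ge> 1 \<Longrightarrow> cmod (npow s n) \<le> 1 * \<omega> n"
  using norm_npow_le_1[of s n] weight_ge_1[of n] by simp

end

text \<open>Peeling: once the unit sequences below \<open>k\<close> are removed from \<open>m\<^sup>-\<^sup>s\<close>, multiplication by \<open>k\<^sup>s\<close>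
  leaves a sequence that tends to the \<open>k\<close>-th unit sequence, uniformly in \<open>m\<close>, as \<open>s \<rightarrow> \<infinity>\<close>.\<close>

lemma unit_seq_in_closed_span_npow:
  assumes npow: "\<And>s. s > 0 \<Longrightarrow> P (npow s)"
    and lin: "\<And>g h c. P g \<Longrightarrow> P h \<Longrightarrow> P (\<lambda>m. g m + c * h m)"
    and closed: "\<And>g. (\<And>e. e > 0 \<Longrightarrow> \<exists>h. P h \<and> (\<forall>m\<ge>1. cmod (h m - g m) \<le> e)) \<Longrightarrow> P g"
    and "k \<ge> 1"
  shows "P (unit_seq k)"
  using \<open>k \<ge> 1\<close>
proof (induction k rule: less_induct)
  case (less k)
  have lin_sum: "P (\<lambda>m. g m + (\<Sum>j\<in>F. c j * unit_seq j m))"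
    if "P g" "finite F" "F \<subseteq> {1..<k}" for F g c
    using that(2,3)
  proof induction
    case (insert j F)
    then have "P (\<lambda>m. (g m + (\<Sum>j\<in>F. c j * unit_seq j m)) + c j * unit_seq j m)"
      by (intro lin less.IH) auto
    then show ?case
      using insert by (simp add: algebra_simps)
  qed (simp add: \<open>P g\<close>)
  show ?case
  proof (rule closed)
    fix e :: real assume "e > 0"
    \<comment> \<open>For \<open>m > k\<close> the ratio \<open>k / m\<close> is at most
      \<open>k / (k + 1)\<close>, which makes the convergence uniform in \<open>m\<close>.\<close>
    define q where "q = real k / (real k + 1)"
    have q: "0 \<le> q" "q < 1"
      by (auto simp: q_def)
    \<comment> \<open>The bound by 1 excludes \<open>n = 0\<close>, so that the exponent
      \<open>s = n\<close> is positive as the hypothesis on \<open>npow\<close> demands.\<close>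
    obtain n where n: "q ^ n < min e 1"
      using real_arch_pow_inv[of "min e 1" q] q \<open>e > 0\<close> by auto
    then have "n > 0"
      by (cases n) auto
    define s where "s = real n"
    define h where "h = (\<lambda>m. of_nat k ^ n * (npow s m + (\<Sum>j\<in>{1..<k}. - npow s j * unit_seq j m)))"
    have npow_s: "npow s m = inverse (of_nat m ^ n)" if "m \<ge> 1" for m
      using that by (simp add: npow_def s_def powr_minus powr_realpow)
    have P0: "P (\<lambda>m. npow s m + (\<Sum>j\<in>{1..<k}. - npow s j * unit_seq j m))"
      using npow[of s] \<open>n > 0\<close> by (intro lin_sum) (auto simp: s_def)
    \<comment> \<open>Closure under \<open>g + c * h\<close> yields scalar multiples by taking
      \<open>h = g\<close> and \<open>c = k ^ n - 1\<close>.\<close>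
    have "P h"
      using lin[OF P0 P0, of "of_nat k ^ n - 1"] by (simp add: h_def algebra_simps)
    moreover have "cmod (h m - unit_seq k m) \<le> e" if "m \<ge> 1" for m
    proof -
      have sum: "(\<Sum>j\<in>{1..<k}. - npow s j * unit_seq j m) = (if m < k then - npow s m else 0)"
        using that sum.delta[of "{1..<k}" m "\<lambda>j. - npow s j"] by (simp add: unit_seq_def if_distrib cong: if_cong)
      consider "m < k" | "m = k" | "m > k" by linarith
      then show ?thesis
      proof cases
        case 1
        then show ?thesis using sum \<open>e > 0\<close> by (simp add: h_def unit_seq_def)
      next
        case 2
        then show ?thesis using sum \<open>e > 0\<close> less.prems by (simp add: h_def unit_seq_def npow_s)
      next
        case 3
        then have "h m - unit_seq k m = (of_nat k / of_nat m) ^ n"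
          using sum less.prems by (simp add: h_def unit_seq_def npow_s divide_inverse power_mult_distrib power_inverse)
        then have "cmod (h m - unit_seq k m) = (real k / real m) ^ n"
          by (simp add: norm_power norm_divide)
        also have "\<dots> \<le> q ^ n"
          using 3 by (intro power_mono) (auto simp: q_def intro!: divide_left_mono)
        finally show ?thesis using n by simp
      qed
    qed
    ultimately show "\<exists>h. P h \<and> (\<forall>m\<ge>1. cmod (h m - unit_seq k m) \<le> e)"
      by blast
  qed
qed

text \<open>The values of a character on the unit sequences. For a multiplicative sequence
  \<open>\<psi> 1 = 1\<close> expresses that it is nonzero on \<open>{1..}\<close>;
  \<open>\<psi> 0 = 0\<close> fixes the value outside the semigroup.\<close>

definition char_seqs :: "(nat \<Rightarrow> real) \<Rightarrow> (nat \<Rightarrow> complex) set" where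
  "char_seqs \<omega> = {\<psi>. \<psi> 0 = 0 \<and> (\<forall>m\<ge>1. \<forall>n\<ge>1. \<psi> (m * n) = \<psi> m * \<psi> n) \<and> \<psi> 1 = 1 \<and> (\<forall>n\<ge>1. cmod (\<psi> n) \<le> \<omega> n)}"

lemma char_seqs_mult: "\<psi> \<in> char_seqs \<omega> \<Longrightarrow> m \<ge> 1 \<Longrightarrow> n \<ge> 1 \<Longrightarrow> \<psi> (m * n) = \<psi> m * \<psi> n"
  by (simp add: char_seqs_def)

lemma char_seqs_bound: "\<psi> \<in> char_seqs \<omega> \<Longrightarrow> n \<ge> 1 \<Longrightarrow> cmod (\<psi> n) \<le> 1 * \<omega> n"
  by (simp add: char_seqs_def)

section \<open>Uniqueness of coefficients and the algebra laws of the convolution\<close>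

context weighted_l1
begin

lemma char_seqs_npow:
  assumes "\<psi> \<in> char_seqs \<omega>" "s \<ge> 0"
  shows "(\<lambda>n. \<psi> n * npow s n) \<in> char_seqs \<omega>"
proof -
  have "cmod (\<psi> n * npow s n) \<le> \<omega> n * 1" if "n \<ge> 1" for n
    unfolding norm_mult using assms that norm_npow_le_1[of s n] weight_ge_1[of n]
    by (intro mult_mono) (auto simp: char_seqs_def)
  then show ?thesis
    using assms by (simp add: char_seqs_def npow_mult) (simp add: npow_def)
qed

lemma npow_in_char_seqs: "s \<ge> 0 \<Longrightarrow> npow s \<in> char_seqs \<omega>"
  using npow_bound[of s] by (simp add: char_seqs_def npow_mult) (simp add: npow_def)

text \<open>The weight-bounded sequences annihilated by the difference \<open>d\<close> form a
  linear space closed under uniform limits. It contains every \<open>npow s\<close>, hence every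
  unit sequence, and so all coefficients of \<open>d\<close> vanish.\<close>

lemma l1_eqI:
  assumes a: "a \<in> l1_carrier \<omega>" and b: "b \<in> l1_carrier \<omega>"
    and eq: "\<And>s. s > 0 \<Longrightarrow> pairing a (npow s) = pairing b (npow s)"
  shows "a = b"
proof -
  define d where "d = (\<lambda>n. a n - b n)"
  have d: "d \<in> l1_carrier \<omega>"
    using l1_diff(1)[OF a b] by (simp add: d_def)
  define P where "P g \<longleftrightarrow> (\<exists>K. \<forall>m\<ge>1. cmod (g m) \<le> K * \<omega> m) \<and> pairing d g = 0" for g
  have "d k = 0" if "k \<ge> 1" for k
  proof -
    have "P (unit_seq k)"
    proof (rule unit_seq_in_closed_span_npow[OF _ _ _ that])
      fix s :: real assume "s > 0"
      then show "P (npow s)"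
        unfolding P_def d_def using pairing_diff_left[OF a b npow_bound[of s]] npow_bound[of s] eq[of s]
        by (auto intro!: exI[of _ 1])
    next
      fix g h c assume "P g" "P h"
      then obtain K L where K: "\<And>m. m \<ge> 1 \<Longrightarrow> cmod (g m) \<le> K * \<omega> m"
        and L: "\<And>m. m \<ge> 1 \<Longrightarrow> cmod (h m) \<le> L * \<omega> m"
        unfolding P_def by blast
      have cL: "cmod (c * h m) \<le> (cmod c * L) * \<omega> m" if "m \<ge> 1" for m
        using mult_left_mono[OF L[OF that], of "cmod c"] by (simp add: norm_mult mult_ac)
      have "cmod (g m + c * h m) \<le> (K + cmod c * L) * \<omega> m" if "m \<ge> 1" for m
        using norm_triangle_ineq[of "g m" "c * h m"] K[OF that] cL[OF that] by (simp add: distrib_right)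
      moreover have "pairing d (\<lambda>m. g m + c * h m) = 0"
        using \<open>P g\<close> \<open>P h\<close> pairing_add_right[OF d K cL] by (simp add: P_def pairing_scale_right)
      ultimately show "P (\<lambda>m. g m + c * h m)"
        unfolding P_def by blast
    next
      fix g assume approx: "\<exists>h. P h \<and> (\<forall>m\<ge>1. cmod (h m - g m) \<le> e)" if "e > 0" for e
      have step: "(\<exists>K. \<forall>m\<ge>1. cmod (g m) \<le> K * \<omega> m) \<and> cmod (pairing d g) \<le> e * l1_norm \<omega> d"
        if "e > 0" for e
      proof -
        obtain h K where h: "pairing d h = 0" and K: "\<And>m. m \<ge> 1 \<Longrightarrow> cmod (h m) \<le> K * \<omega> m"
          and e: "\<And>m. m \<ge> 1 \<Longrightarrow> cmod (h m - g m) \<le> e"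
          using approx[OF \<open>e > 0\<close>] unfolding P_def by blast
        \<comment> \<open>Since \<open>\<omega> \<ge> 1\<close>, a uniform error is also an error
          relative to the weight, which is the form the pairing estimate needs.\<close>
        have e': "cmod (g m - h m) \<le> e * \<omega> m" if "m \<ge> 1" for m
        proof -
          have "e \<le> e * \<omega> m"
            using weight_ge_1[OF that] \<open>e > 0\<close> by simp
          then show ?thesis
            using e[OF that] by (simp add: norm_minus_commute)
        qed
        have "cmod (g m) \<le> (K + e) * \<omega> m" if "m \<ge> 1" for m
          using norm_triangle_ineq[of "h m" "g m - h m"] K[OF that] e'[OF that] by (simp add: distrib_right)
        moreover have "pairing d g = pairing d (\<lambda>m. g m - h m)"
          using pairing_add_right[OF d K e'] h by simp
        ultimately show ?thesis
          using pairing_summable(3)[OF d e'] by auto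
      qed
      have "cmod (pairing d g) \<le> 0"
      proof (rule field_le_epsilon)
        fix e :: real assume "e > 0"
        have "e / (l1_norm \<omega> d + 1) * l1_norm \<omega> d \<le> e"
          using l1_norm_nonneg[of d] \<open>e > 0\<close> by (simp add: field_simps)
        then show "cmod (pairing d g) \<le> 0 + e"
          using step[of "e / (l1_norm \<omega> d + 1)"] l1_norm_nonneg[of d] \<open>e > 0\<close> by simp
      qed
      then show "P g"
        unfolding P_def using step[of 1] by simp
    qed
    then show ?thesis
      using pairing_unit_seq_right[OF that] by (simp add: P_def)
  qed
  moreover have "d 0 = 0"
    using d by (simp add: l1_carrier_def)
  ultimately have "d n = 0" for n
    by (cases "n \<ge> 1") (auto simp: not_le)
  then show ?thesis
    by (simp add: d_def fun_eq_iff)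
qed

lemma pairing_conv_npow:
  assumes "a \<in> l1_carrier \<omega>" "b \<in> l1_carrier \<omega>" "s > 0"
  shows "pairing (dirichlet_conv a b) (npow s) = pairing a (npow s) * pairing b (npow s)"
  using pairing_conv[OF assms(1,2) npow_mult npow_bound[of s]] assms(3) by simp

text \<open>The map \<open>a \<mapsto> pairing a (npow s)\<close> is multiplicative, and jointly
  over \<open>s > 0\<close> injective, so the laws of the convolution are inherited from
  multiplication of complex numbers.\<close>

lemma dirichlet_conv_commute:
  assumes "a \<in> l1_carrier \<omega>" "b \<in> l1_carrier \<omega>"
  shows "dirichlet_conv a b = dirichlet_conv b a"
  by (rule l1_eqI) (simp_all add: assms l1_conv pairing_conv_npow mult.commute)

lemma dirichlet_conv_assoc:
  assumes "a \<in> l1_carrier \<omega>" "b \<in> l1_carrier \<omega>" "c \<in> l1_carrier \<omega>"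
  shows "dirichlet_conv (dirichlet_conv a b) c = dirichlet_conv a (dirichlet_conv b c)"
  by (rule l1_eqI) (simp_all add: assms l1_conv pairing_conv_npow mult.assoc)

lemma dirichlet_conv_unit:
  assumes "a \<in> l1_carrier \<omega>"
  shows "dirichlet_conv a (unit_seq 1) = a"
  by (rule l1_eqI)
    (simp_all add: assms l1_conv pairing_conv_npow unit_seq_in_l1 pairing_unit_seq_left, simp add: npow_def)

end

lemma dirichlet_conv_add_right:
  "dirichlet_conv a (\<lambda>n. b n + c n) = (\<lambda>n. dirichlet_conv a b n + dirichlet_conv a c n)"
  by (auto simp: dirichlet_conv_def algebra_simps sum.distrib)

lemma dirichlet_conv_scale_right:
  "dirichlet_conv a (\<lambda>n. c * b n) = (\<lambda>n. c * dirichlet_conv a b n)"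
  by (auto simp: dirichlet_conv_def mult.left_commute[of _ c] sum_distrib_left)

lemma dirichlet_conv_unit_seq:
  assumes "m \<ge> 1" "n \<ge> 1"
  shows "dirichlet_conv (unit_seq m) (unit_seq n) = unit_seq (m * n)"
proof
  fix k
  show "dirichlet_conv (unit_seq m) (unit_seq n) k = unit_seq (m * n) k"
  proof (cases "k = 0")
    case False
    then have "dirichlet_conv (unit_seq m) (unit_seq n) k
        = (\<Sum>d | d dvd k. unit_seq m d * unit_seq n (k div d))"
      by (simp add: dirichlet_conv_def)
    also have "\<dots> = (\<Sum>d | d dvd k. if d = m then unit_seq n (k div m) else 0)"
      by (intro sum.cong) (auto simp: unit_seq_def)
    also have "\<dots> = unit_seq (m * n) k"
      using False assms by (subst sum.delta) (auto simp: unit_seq_def)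
    finally show ?thesis .
  qed (use assms in \<open>simp add: dirichlet_conv_def unit_seq_def\<close>)
qed

section \<open>Characters of the sequence algebra\<close>

lemma sum_unit_seq:
  "finite F \<Longrightarrow> (\<Sum>k\<in>F. c k * unit_seq k m) = (if m \<in> F then c m else 0)"
  using sum.delta[of F m c] by (simp add: unit_seq_def if_distrib cong: if_cong)

context weighted_l1
begin

lemma l1_truncate:
  assumes a: "a \<in> l1_carrier \<omega>" and "e > 0"
  obtains F where "finite F" "F \<subseteq> {1..}" "l1_norm \<omega> (\<lambda>n. a n - (if n \<in> F then a n else 0)) \<le> e"
proof -
  obtain F where F: "finite F" "F \<subseteq> {1..}"
    and dist: "dist (\<Sum>n\<in>F. cmod (a n) * \<omega> n) (l1_norm \<omega> a) \<le> e"
    using infsum_finite_approximation[OF l1_summable[OF a] \<open>e > 0\<close>] unfolding l1_norm_def by blast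
  have "l1_norm \<omega> (\<lambda>n. a n - (if n \<in> F then a n else 0)) \<le> e"
  proof (rule l1_boundedI(2))
    show "a 0 - (if 0 \<in> F then a 0 else 0) = 0"
      using a by (simp add: l1_carrier_def)
    fix G :: "nat set" assume G: "finite G" "G \<subseteq> {1..}"
    have "(\<Sum>n\<in>G. cmod (a n - (if n \<in> F then a n else 0)) * \<omega> n) = (\<Sum>n\<in>G - F. cmod (a n) * \<omega> n)"
      using G by (intro sum.mono_neutral_cong_right) auto
    \<comment> \<open>The part of \<open>G\<close> outside \<open>F\<close> has at most the mass
      that \<open>F\<close> leaves over from the norm, which is at most \<open>e\<close>.\<close>
    moreover have "(\<Sum>n\<in>(G - F) \<union> F. cmod (a n) * \<omega> n)
        = (\<Sum>n\<in>G - F. cmod (a n) * \<omega> n) + (\<Sum>n\<in>F. cmod (a n) * \<omega> n)"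
      using F G by (intro sum.union_disjoint) auto
    moreover have "(\<Sum>n\<in>(G - F) \<union> F. cmod (a n) * \<omega> n) \<le> l1_norm \<omega> a"
      using F G by (intro l1_finite_le[OF a]) auto
    ultimately show "(\<Sum>n\<in>G. cmod (a n - (if n \<in> F then a n else 0)) * \<omega> n) \<le> e"
      using dist by (simp add: dist_real_def)
  qed
  with F that show ?thesis by blast
qed

text \<open>The clauses of \<open>spectrum_space\<close> for the sequence algebra without
  extensionality, so that characters of any isomorphic algebra can be pulled back to this
  form.\<close>

definition l1_character :: "((nat \<Rightarrow> complex) \<Rightarrow> complex) \<Rightarrow> bool" where
  "l1_character \<Phi> \<longleftrightarrow>
    (\<forall>a\<in>l1_carrier \<omega>. \<forall>b\<in>l1_carrier \<omega>. \<Phi> (\<lambda>n. a n + b n) = \<Phi> a + \<Phi> b) \<and>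
    (\<forall>c. \<forall>a\<in>l1_carrier \<omega>. \<Phi> (\<lambda>n. c * a n) = c * \<Phi> a) \<and>
    (\<forall>a\<in>l1_carrier \<omega>. \<forall>b\<in>l1_carrier \<omega>. \<Phi> (dirichlet_conv a b) = \<Phi> a * \<Phi> b) \<and>
    (\<exists>a\<in>l1_carrier \<omega>. \<Phi> a \<noteq> 0)"

text \<open>A violation could be rescaled to some \<open>b\<close> of norm below 1 with
  \<open>\<Phi> b = 1\<close>; the quasi-inverse \<open>c\<close> of \<open>b\<close> would then
  satisfy \<open>\<Phi> c = 1 + \<Phi> c\<close>.\<close>

lemma l1_character_norm_le:
  assumes \<Phi>: "l1_character \<Phi>" and a: "a \<in> l1_carrier \<omega>"
  shows "cmod (\<Phi> a) \<le> l1_norm \<omega> a"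
proof (rule ccontr)
  assume "\<not> ?thesis"
  then have less: "l1_norm \<omega> a < cmod (\<Phi> a)" by simp
  then have nz: "\<Phi> a \<noteq> 0"
    using l1_norm_nonneg[of a] by auto
  define b where "b = (\<lambda>n. (1 / \<Phi> a) * a n)"
  have b: "b \<in> l1_carrier \<omega>"
    unfolding b_def by (rule l1_scale(1)[OF a])
  have "l1_norm \<omega> b < 1"
    unfolding b_def l1_scale(2)[OF a] using less nz by (simp add: norm_divide divide_simps)
  then obtain c where c: "c \<in> l1_carrier \<omega>" and eq: "c = (\<lambda>n. b n + dirichlet_conv b c n)"
    using l1_geometric_series[OF b] by blast
  have "\<Phi> b = (1 / \<Phi> a) * \<Phi> a"
    unfolding b_def using \<Phi> a unfolding l1_character_def by blast
  then have \<Phi>b: "\<Phi> b = 1"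
    using nz by simp
  have "\<Phi> c = \<Phi> (\<lambda>n. b n + dirichlet_conv b c n)"
    using eq by simp
  also have "\<dots> = \<Phi> b + \<Phi> (dirichlet_conv b c)"
    using \<Phi> b l1_conv(1)[OF b c] unfolding l1_character_def by blast
  also have "\<Phi> (dirichlet_conv b c) = \<Phi> b * \<Phi> c"
    using \<Phi> b c unfolding l1_character_def by blast
  finally show False
    using \<Phi>b by simp
qed

lemma l1_character_pairing:
  assumes \<psi>: "\<psi> \<in> char_seqs \<omega>"
  shows "l1_character (\<lambda>a. pairing a \<psi>)"
proof -
  have "pairing (unit_seq 1) \<psi> \<noteq> 0"
    using \<psi> by (simp add: pairing_unit_seq_left char_seqs_def)
  then show ?thesis
    unfolding l1_character_def
    using pairing_add_left[OF _ _ char_seqs_bound[OF \<psi>]] pairing_scale_left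
      pairing_conv[OF _ _ char_seqs_mult[OF \<psi>] char_seqs_bound[OF \<psi>]] unit_seq_in_l1[of 1]
    by blast
qed

text \<open>Take \<open>\<psi> n\<close> to be the value of \<open>\<Phi>\<close> on the
  \<open>n\<close>-th unit sequence. Both functionals agree on finite truncations and are
  contractive, so their difference at \<open>a\<close> is at most twice the norm of an arbitrarily
  small tail.\<close>

lemma l1_character_eq_pairing:
  assumes \<Phi>: "l1_character \<Phi>"
  obtains \<psi> where "\<psi> \<in> char_seqs \<omega>" "\<And>a. a \<in> l1_carrier \<omega> \<Longrightarrow> \<Phi> a = pairing a \<psi>"
proof -
  have add: "\<Phi> (\<lambda>n. a n + b n) = \<Phi> a + \<Phi> b" if "a \<in> l1_carrier \<omega>" "b \<in> l1_carrier \<omega>" for a b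
    using \<Phi> that unfolding l1_character_def by blast
  have scale: "\<Phi> (\<lambda>n. c * a n) = c * \<Phi> a" if "a \<in> l1_carrier \<omega>" for c a
    using \<Phi> that unfolding l1_character_def by blast
  have conv: "\<Phi> (dirichlet_conv a b) = \<Phi> a * \<Phi> b" if "a \<in> l1_carrier \<omega>" "b \<in> l1_carrier \<omega>" for a b
    using \<Phi> that unfolding l1_character_def by blast
  obtain a1 where a1: "a1 \<in> l1_carrier \<omega>" "\<Phi> a1 \<noteq> 0"
    using \<Phi> unfolding l1_character_def by blast
  define \<psi> where "\<psi> n = (if n = 0 then 0 else \<Phi> (unit_seq n))" for n
  have "\<Phi> a1 * \<Phi> (unit_seq 1) = \<Phi> a1"
    using conv[OF a1(1) unit_seq_in_l1[of 1]] dirichlet_conv_unit[OF a1(1)] by simp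
  then have "\<Phi> (unit_seq 1) = 1"
    using a1(2) by simp
  then have \<psi>: "\<psi> \<in> char_seqs \<omega>"
    using conv unit_seq_in_l1 dirichlet_conv_unit_seq
      l1_character_norm_le[OF \<Phi> unit_seq_in_l1] l1_norm_unit_seq
    unfolding char_seqs_def \<psi>_def by (auto simp: Suc_le_eq) (metis Suc_leI One_nat_def mult_eq_0_iff not_gr0)
  have finite: "(\<lambda>n. if n \<in> F then a n else 0) \<in> l1_carrier \<omega> \<and>
      \<Phi> (\<lambda>n. if n \<in> F then a n else 0) = pairing (\<lambda>n. if n \<in> F then a n else 0) \<psi>"
    if "finite F" "F \<subseteq> {1..}" for F a
    using that
  proof induction
    case empty
    then show ?case
      using l1_zero scale[OF l1_zero(1), of 0] by (simp add: pairing_def)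
  next
    case (insert k F)
    define u where "u = (\<lambda>n. a k * unit_seq k n)"
    define t where "t = (\<lambda>n. if n \<in> F then a n else 0)"
    have k: "k \<ge> 1" using insert by simp
    have u: "u \<in> l1_carrier \<omega>"
      unfolding u_def by (intro l1_scale(1) unit_seq_in_l1 k)
    have t: "t \<in> l1_carrier \<omega>" "\<Phi> t = pairing t \<psi>"
      using insert by (auto simp: t_def)
    have eq: "(\<lambda>n. if n \<in> insert k F then a n else 0) = (\<lambda>n. u n + t n)"
      using insert.hyps by (auto simp: u_def t_def unit_seq_def)
    have "\<Phi> u = pairing u \<psi>"
      unfolding u_def using scale[OF unit_seq_in_l1[OF k]] k
      by (simp add: pairing_scale_left pairing_unit_seq_left \<psi>_def)
    then show ?case
      unfolding eq using l1_add(1)[OF u t(1)] add[OF u t(1)] t(2)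
        pairing_add_left[OF u t(1) char_seqs_bound[OF \<psi>]] by simp
  qed
  have "\<Phi> a = pairing a \<psi>" if a: "a \<in> l1_carrier \<omega>" for a
  proof -
    define \<Psi> where "\<Psi> b = \<Phi> b - pairing b \<psi>" for b
    have "cmod (\<Psi> a) \<le> 0"
    proof (rule field_le_epsilon)
      fix e :: real assume "e > 0"
      then obtain F where F: "finite F" "F \<subseteq> {1..}"
        and le: "l1_norm \<omega> (\<lambda>n. a n - (if n \<in> F then a n else 0)) \<le> e / 2"
        using l1_truncate[OF a, of "e / 2"] by auto
      define t where "t = (\<lambda>n. if n \<in> F then a n else 0)"
      define d where "d = (\<lambda>n. a n - t n)"
      have t: "t \<in> l1_carrier \<omega>" "\<Phi> t = pairing t \<psi>"
        using finite[OF F] by (auto simp: t_def)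
      have d: "d \<in> l1_carrier \<omega>" "l1_norm \<omega> d \<le> e / 2"
        unfolding d_def using l1_diff(1)[OF a t(1)] le by (auto simp: t_def)
      have "a = (\<lambda>n. d n + t n)"
        by (simp add: d_def)
      then have "\<Psi> a = \<Psi> d"
        using add[OF d(1) t(1)] pairing_add_left[OF d(1) t(1) char_seqs_bound[OF \<psi>]] t(2)
        by (simp add: \<Psi>_def)
      then have "cmod (\<Psi> a) \<le> cmod (\<Phi> d) + cmod (pairing d \<psi>)"
        by (simp add: \<Psi>_def norm_triangle_ineq4)
      also have "\<dots> \<le> e / 2 + e / 2"
        using l1_character_norm_le[OF \<Phi> d(1)] l1_character_norm_le[OF l1_character_pairing[OF \<psi>] d(1)] d(2)
        by simp
      finally show "cmod (\<Psi> a) \<le> 0 + e" by simp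
    qed
    then show ?thesis by (simp add: \<Psi>_def)
  qed
  with \<psi> that show ?thesis by blast
qed

text \<open>The majorant \<open>|a n| \<omega> n\<close> is independent of \<open>s \<ge> 0\<close>,
  so convergence is uniform up to and including the endpoint 0, where continuity will be
  used.\<close>

lemma continuous_on_pairing_npow:
  assumes a: "a \<in> l1_carrier \<omega>" and \<psi>: "\<psi> \<in> char_seqs \<omega>"
  shows "continuous_on {0..} (\<lambda>s. pairing a (\<lambda>n. \<psi> n * npow s n))"
  unfolding pairing_def
proof (rule uniform_limit_theorem)
  show "uniform_limit {0..} (\<lambda>X s. \<Sum>n\<in>X. a n * (\<psi> n * npow s n))
      (\<lambda>s. \<Sum>\<^sub>\<infinity>n\<in>{1..}. a n * (\<psi> n * npow s n)) (finite_subsets_at_top {1..})"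
  proof (rule Weierstrass_m_test_general[OF _ l1_summable[OF a]])
    fix n :: nat and s :: real assume "n \<in> {1..}" "s \<in> {0..}"
    then show "cmod (a n * (\<psi> n * npow s n)) \<le> cmod (a n) * \<omega> n"
      using char_seqs_bound[OF char_seqs_npow[OF \<psi>], of s n]
      by (simp add: norm_mult[of "a n"] mult_left_mono)
  qed
  show "\<forall>\<^sub>F X in finite_subsets_at_top {1..}.
      continuous_on {0..} (\<lambda>s. \<Sum>n\<in>X. a n * (\<psi> n * npow s n))"
  proof (rule eventually_finite_subsets_at_top_weakI)
    fix X :: "nat set" assume "finite X" "X \<subseteq> {1..}"
    then show "continuous_on {0..} (\<lambda>s. \<Sum>n\<in>X. a n * (\<psi> n * npow s n))"
      unfolding npow_def by (intro continuous_intros) auto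
  qed
qed simp

end

section \<open>Representation of functionals bounded on the span of the characters\<close>

text \<open>Here \<open>\<tau> \<psi>\<close> stands for the value of a BSE-function at the
  character with sequence \<open>\<psi>\<close>, and \<open>K\<close> for any bound of the
  combination in the norm \<open>sup |g m| / \<omega> m\<close>, which replaces the dual
  norm.\<close>

locale bounded_on_characters = weighted_l1 +
  fixes \<tau> :: "(nat \<Rightarrow> complex) \<Rightarrow> complex" and C :: real
  assumes C_nonneg: "C \<ge> 0"
    and bse: "\<And>I c K. finite I \<Longrightarrow> I \<subseteq> char_seqs \<omega> \<Longrightarrow>
      (\<And>m. m \<ge> 1 \<Longrightarrow> cmod (\<Sum>\<psi>\<in>I. c \<psi> * \<psi> m) \<le> K * \<omega> m) \<Longrightarrow>
      cmod (\<Sum>\<psi>\<in>I. c \<psi> * \<tau> \<psi>) \<le> C * K"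
begin

text \<open>The closure, in the norm \<open>sup |g m| / \<omega> m\<close>, of the graph of the linear extension of \<open>\<tau>\<close>
  to the span of the characters.\<close>

definition closed_graph :: "(nat \<Rightarrow> complex) \<Rightarrow> complex \<Rightarrow> bool" where
  "closed_graph g z \<longleftrightarrow> (\<forall>e>0. \<exists>I c. finite I \<and> I \<subseteq> char_seqs \<omega> \<and>
     (\<forall>m\<ge>1. cmod ((\<Sum>\<psi>\<in>I. c \<psi> * \<psi> m) - g m) \<le> e * \<omega> m) \<and>
     cmod ((\<Sum>\<psi>\<in>I. c \<psi> * \<tau> \<psi>) - z) \<le> e)"

lemma closed_graphE:
  assumes "closed_graph g z" "e > 0"
  obtains I c where "finite I" "I \<subseteq> char_seqs \<omega>"
    "\<And>m. m \<ge> 1 \<Longrightarrow> cmod ((\<Sum>\<psi>\<in>I. c \<psi> * \<psi> m) - g m) \<le> e * \<omega> m"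
    "cmod ((\<Sum>\<psi>\<in>I. c \<psi> * \<tau> \<psi>) - z) \<le> e"
proof -
  from assms have "\<exists>I c. finite I \<and> I \<subseteq> char_seqs \<omega> \<and>
     (\<forall>m\<ge>1. cmod ((\<Sum>\<psi>\<in>I. c \<psi> * \<psi> m) - g m) \<le> e * \<omega> m) \<and>
     cmod ((\<Sum>\<psi>\<in>I. c \<psi> * \<tau> \<psi>) - z) \<le> e"
    unfolding closed_graph_def by (elim allE impE)
  then show thesis
    by (elim exE conjE) (rule that, auto)
qed

lemma closed_graph_zero: "closed_graph (\<lambda>m. 0) 0"
  unfolding closed_graph_def
proof (intro allI impI)
  fix e :: real assume "e > 0"
  then have "0 \<le> e * \<omega> m" if "m \<ge> 1" for m
    using weight_ge_1[OF that] by simp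
  then show "\<exists>I c. finite I \<and> I \<subseteq> char_seqs \<omega> \<and>
     (\<forall>m\<ge>1. cmod ((\<Sum>\<psi>\<in>I. c \<psi> * \<psi> m) - 0) \<le> e * \<omega> m) \<and>
     cmod ((\<Sum>\<psi>\<in>I. c \<psi> * \<tau> \<psi>) - 0) \<le> e"
    using \<open>e > 0\<close> by (intro exI[of _ "{}"]) simp
qed

lemma closed_graph_char:
  assumes "\<psi> \<in> char_seqs \<omega>"
  shows "closed_graph \<psi> (\<tau> \<psi>)"
  unfolding closed_graph_def
proof (intro allI impI exI[of _ "{\<psi>}"] exI[of _ "\<lambda>_. 1"] conjI)
  fix e :: real and m :: nat assume "e > 0" "m \<ge> 1"
  then show "cmod ((\<Sum>\<psi>\<in>{\<psi>}. 1 * \<psi> m) - \<psi> m) \<le> e * \<omega> m"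
    using weight_ge_1[of m] by simp
qed (use assms in auto)

lemma closed_graph_lin:
  assumes "closed_graph g z" "closed_graph h w"
  shows "closed_graph (\<lambda>m. g m + t * h m) (z + t * w)"
  unfolding closed_graph_def
proof (intro allI impI)
  fix e :: real assume "e > 0"
  define e' where "e' = e / (1 + cmod t)"
  have pos: "1 + cmod t > 0"
    by (simp add: add_pos_nonneg)
  have "e' + cmod t * e' = (1 + cmod t) * e'"
    by (simp add: distrib_right)
  then have e': "e' > 0" "e' + cmod t * e' = e"
    using \<open>e > 0\<close> pos by (simp_all add: e'_def)
  obtain I c where I: "finite I" "I \<subseteq> char_seqs \<omega>"
    and Ig: "\<And>m. m \<ge> 1 \<Longrightarrow> cmod ((\<Sum>\<psi>\<in>I. c \<psi> * \<psi> m) - g m) \<le> e' * \<omega> m"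
    and Iz: "cmod ((\<Sum>\<psi>\<in>I. c \<psi> * \<tau> \<psi>) - z) \<le> e'"
    by (rule closed_graphE[OF assms(1) e'(1)]) (rule that; assumption)
  obtain J d where J: "finite J" "J \<subseteq> char_seqs \<omega>"
    and Jh: "\<And>m. m \<ge> 1 \<Longrightarrow> cmod ((\<Sum>\<psi>\<in>J. d \<psi> * \<psi> m) - h m) \<le> e' * \<omega> m"
    and Jw: "cmod ((\<Sum>\<psi>\<in>J. d \<psi> * \<tau> \<psi>) - w) \<le> e'"
    by (rule closed_graphE[OF assms(2) e'(1)]) (rule that; assumption)
  \<comment> \<open>The two combinations are put on the common index set \<open>I \<union> J\<close>
    by extending their coefficients by 0; characters in both sets receive the sum.\<close>
  define b where "b \<psi> = (if \<psi> \<in> I then c \<psi> else 0) + t * (if \<psi> \<in> J then d \<psi> else 0)" for \<psi>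
  have b: "(\<Sum>\<psi>\<in>I \<union> J. b \<psi> * f \<psi>) = (\<Sum>\<psi>\<in>I. c \<psi> * f \<psi>) + t * (\<Sum>\<psi>\<in>J. d \<psi> * f \<psi>)" for f
  proof -
    have "(\<Sum>\<psi>\<in>I \<union> J. (if \<psi> \<in> I then c \<psi> else 0) * f \<psi>) = (\<Sum>\<psi>\<in>I. c \<psi> * f \<psi>)"
      using I J by (intro sum.mono_neutral_cong_right) auto
    moreover have "(\<Sum>\<psi>\<in>I \<union> J. (if \<psi> \<in> J then d \<psi> else 0) * f \<psi>) = (\<Sum>\<psi>\<in>J. d \<psi> * f \<psi>)"
      using I J by (intro sum.mono_neutral_cong_right) auto
    ultimately show ?thesis
      by (simp only: b_def distrib_right sum.distrib mult.assoc sum_distrib_left[symmetric])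
  qed
  have combine: "cmod ((x + t * y) - (x' + t * y')) \<le> r + cmod t * r"
    if "cmod (x - x') \<le> r" "cmod (y - y') \<le> r" for x y x' y' r
  proof -
    have "cmod ((x + t * y) - (x' + t * y')) = cmod ((x - x') + t * (y - y'))"
      by (simp add: algebra_simps)
    also have "\<dots> \<le> cmod (x - x') + cmod t * cmod (y - y')"
      using norm_triangle_ineq[of "x - x'" "t * (y - y')"] by (simp add: norm_mult)
    also have "\<dots> \<le> r + cmod t * r"
      using that by (intro add_mono mult_left_mono) auto
    finally show ?thesis .
  qed
  have "cmod ((\<Sum>\<psi>\<in>I \<union> J. b \<psi> * \<psi> m) - (g m + t * h m)) \<le> e * \<omega> m" if "m \<ge> 1" for m
  proof -
    have "e * \<omega> m = e' * \<omega> m + cmod t * (e' * \<omega> m)"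
      by (simp add: e'(2)[symmetric] distrib_right)
    then show ?thesis
      using combine[OF Ig[OF that] Jh[OF that]] by (simp only: b[of "\<lambda>\<psi>. \<psi> m"])
  qed
  moreover have "cmod ((\<Sum>\<psi>\<in>I \<union> J. b \<psi> * \<tau> \<psi>) - (z + t * w)) \<le> e"
    using combine[OF Iz Jw] e'(2) by (simp add: b)
  ultimately show "\<exists>I c. finite I \<and> I \<subseteq> char_seqs \<omega> \<and>
     (\<forall>m\<ge>1. cmod ((\<Sum>\<psi>\<in>I. c \<psi> * \<psi> m) - (g m + t * h m)) \<le> e * \<omega> m) \<and>
     cmod ((\<Sum>\<psi>\<in>I. c \<psi> * \<tau> \<psi>) - (z + t * w)) \<le> e"
    using I J by (intro exI[of _ "I \<union> J"] exI[of _ b]) auto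
qed

text \<open>Approximating within \<open>e\<close> costs \<open>C * e\<close> from the inequality
  \<open>bse\<close> and \<open>e\<close> from the value, which explains
  \<open>e = e' / (C + 1)\<close>. Applied to differences with \<open>K = 0\<close>, the bound shows
  that \<open>g\<close> determines \<open>z\<close>.\<close>

lemma closed_graph_bound:
  assumes "closed_graph g z" and g: "\<And>m. m \<ge> 1 \<Longrightarrow> cmod (g m) \<le> K * \<omega> m"
  shows "cmod z \<le> C * K"
proof (rule field_le_epsilon)
  fix e' :: real assume "e' > 0"
  define e where "e = e' / (C + 1)"
  have "C * e + e = (C + 1) * e"
    by (simp add: distrib_right)
  then have e: "e > 0" "C * e + e = e'"
    using \<open>e' > 0\<close> C_nonneg by (simp_all add: e_def)
  obtain I c where I: "finite I" "I \<subseteq> char_seqs \<omega>"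
    and Ig: "\<And>m. m \<ge> 1 \<Longrightarrow> cmod ((\<Sum>\<psi>\<in>I. c \<psi> * \<psi> m) - g m) \<le> e * \<omega> m"
    and Iz: "cmod ((\<Sum>\<psi>\<in>I. c \<psi> * \<tau> \<psi>) - z) \<le> e"
    by (rule closed_graphE[OF assms(1) e(1)]) (rule that; assumption)
  have "cmod (\<Sum>\<psi>\<in>I. c \<psi> * \<psi> m) \<le> (K + e) * \<omega> m" if "m \<ge> 1" for m
    using norm_triangle_sub[of "\<Sum>\<psi>\<in>I. c \<psi> * \<psi> m" "g m"] Ig[OF that] g[OF that]
    by (simp add: distrib_right)
  then have "cmod (\<Sum>\<psi>\<in>I. c \<psi> * \<tau> \<psi>) \<le> C * (K + e)"
    by (rule bse[OF I])
  then have "cmod z \<le> C * (K + e) + e"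
    using norm_triangle_sub[of z "\<Sum>\<psi>\<in>I. c \<psi> * \<tau> \<psi>"] Iz by (simp add: norm_minus_commute)
  then show "cmod z \<le> C * K + e'"
    using e(2) by (simp add: distrib_left)
qed

text \<open>The bound applied to differences of approximants makes their values a Cauchy sequence,
  whose limit is a value for \<open>g\<close>.\<close>

lemma closed_graph_complete:
  assumes approx: "\<And>e. e > 0 \<Longrightarrow> \<exists>h w. closed_graph h w \<and> (\<forall>m\<ge>1. cmod (h m - g m) \<le> e * \<omega> m)"
  shows "\<exists>z. closed_graph g z"
proof -
  define \<epsilon> where "\<epsilon> n = inverse (real (Suc n))" for n
  have pos: "\<epsilon> n > 0" for n by (simp add: \<epsilon>_def)
  have "\<exists>p. closed_graph (fst p) (snd p) \<and> (\<forall>m\<ge>1. cmod (fst p m - g m) \<le> \<epsilon> n * \<omega> m)" for n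
    using approx[OF pos[of n]] by auto
  then obtain p where p: "\<And>n. closed_graph (fst (p n)) (snd (p n))"
    and pg: "\<And>n m. m \<ge> 1 \<Longrightarrow> cmod (fst (p n) m - g m) \<le> \<epsilon> n * \<omega> m"
    by metis
  have diff: "cmod (snd (p i) - snd (p j)) \<le> C * (\<epsilon> i + \<epsilon> j)" for i j
  proof (rule closed_graph_bound)
    show "closed_graph (\<lambda>m. fst (p i) m - fst (p j) m) (snd (p i) - snd (p j))"
      using closed_graph_lin[OF p p, of i "-1" j] by simp
    show "cmod (fst (p i) m - fst (p j) m) \<le> (\<epsilon> i + \<epsilon> j) * \<omega> m" if "m \<ge> 1" for m
      using norm_triangle_ineq4[of "fst (p i) m - g m" "fst (p j) m - g m"]
        pg[OF that, of i] pg[OF that, of j] by (simp add: distrib_right)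
  qed
  have \<epsilon>_lim: "\<epsilon> \<longlonglongrightarrow> 0"
    unfolding \<epsilon>_def by (rule LIMSEQ_inverse_real_of_nat)
  have small: "\<exists>N. \<forall>n\<ge>N. \<epsilon> n < e" if "e > 0" for e
    using order_tendstoD(2)[OF \<epsilon>_lim that] by (simp add: eventually_sequentially)
  have "Cauchy (\<lambda>n. snd (p n))"
  proof (rule metric_CauchyI)
    fix e :: real assume "e > 0"
    then have "e / (2 * (C + 1)) > 0"
      using C_nonneg by simp
    then obtain N where N: "\<And>n. n \<ge> N \<Longrightarrow> \<epsilon> n < e / (2 * (C + 1))"
      using small by blast
    have "dist (snd (p i)) (snd (p j)) < e" if "i \<ge> N" "j \<ge> N" for i j
    proof -
      have "C * (\<epsilon> i + \<epsilon> j) \<le> C * (e / (C + 1))"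
        using N[OF that(1)] N[OF that(2)] C_nonneg by (intro mult_left_mono) (auto simp: field_simps)
      also have "\<dots> < e"
        using C_nonneg \<open>e > 0\<close> by (simp add: field_simps)
      finally show ?thesis
        using diff[of i j] by (simp add: dist_norm)
    qed
    then show "\<exists>N. \<forall>i\<ge>N. \<forall>j\<ge>N. dist (snd (p i)) (snd (p j)) < e" by blast
  qed
  then obtain z where z: "(\<lambda>n. snd (p n)) \<longlonglongrightarrow> z"
    by (auto simp: Cauchy_convergent_iff convergent_def)
  have "closed_graph g z"
    unfolding closed_graph_def
  proof (intro allI impI)
    fix e :: real assume "e > 0"
    then obtain N1 where N1: "\<And>n. n \<ge> N1 \<Longrightarrow> \<epsilon> n < e / 2"
      using small[of "e / 2"] by auto
    obtain N2 where N2: "\<And>n. n \<ge> N2 \<Longrightarrow> dist (snd (p n)) z < e / 2"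
      using metric_LIMSEQ_D[OF z, of "e / 2"] \<open>e > 0\<close> by auto
    define n where "n = max N1 N2"
    obtain I c where I: "finite I" "I \<subseteq> char_seqs \<omega>"
      and Ig: "\<And>m. m \<ge> 1 \<Longrightarrow> cmod ((\<Sum>\<psi>\<in>I. c \<psi> * \<psi> m) - fst (p n) m) \<le> e / 2 * \<omega> m"
      and Iz: "cmod ((\<Sum>\<psi>\<in>I. c \<psi> * \<tau> \<psi>) - snd (p n)) \<le> e / 2"
      by (rule closed_graphE[OF p half_gt_zero[OF \<open>e > 0\<close>]]) (rule that; assumption)
    have "cmod ((\<Sum>\<psi>\<in>I. c \<psi> * \<psi> m) - g m) \<le> e * \<omega> m" if "m \<ge> 1" for m
    proof -
      have "cmod ((\<Sum>\<psi>\<in>I. c \<psi> * \<psi> m) - g m) \<le> e / 2 * \<omega> m + \<epsilon> n * \<omega> m"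
        using norm_triangle_le[OF add_mono[OF Ig[OF that] pg[OF that, of n]]] by simp
      also have "\<dots> \<le> e / 2 * \<omega> m + e / 2 * \<omega> m"
        using N1[of n] weight_ge_1[OF that] by (intro add_left_mono mult_right_mono) (auto simp: n_def)
      finally show ?thesis by simp
    qed
    moreover have "cmod ((\<Sum>\<psi>\<in>I. c \<psi> * \<tau> \<psi>) - z) \<le> e"
      using norm_triangle_le[OF add_mono[OF Iz less_imp_le[OF N2[of n, unfolded dist_norm]]]]
      by (simp add: n_def)
    ultimately show "\<exists>I c. finite I \<and> I \<subseteq> char_seqs \<omega> \<and>
        (\<forall>m\<ge>1. cmod ((\<Sum>\<psi>\<in>I. c \<psi> * \<psi> m) - g m) \<le> e * \<omega> m) \<and>
        cmod ((\<Sum>\<psi>\<in>I. c \<psi> * \<tau> \<psi>) - z) \<le> e"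
      using I by blast
  qed
  then show ?thesis ..
qed

text \<open>The peeling argument is applied to the domain of the closed graph. It supplies uniform
  approximations, and these are approximations in the weighted norm because
  \<open>\<omega> \<ge> 1\<close>.\<close>

lemma closed_graph_unit_seq:
  assumes "k \<ge> 1"
  shows "\<exists>z. closed_graph (unit_seq k) z"
proof (rule unit_seq_in_closed_span_npow[OF _ _ _ assms])
  fix s :: real assume "s > 0"
  then show "\<exists>z. closed_graph (npow s) z"
    using closed_graph_char[OF npow_in_char_seqs[of s]] by auto
next
  fix g h c assume "\<exists>z. closed_graph g z" "\<exists>z. closed_graph h z"
  then show "\<exists>z. closed_graph (\<lambda>m. g m + c * h m) z"
    using closed_graph_lin by blast
next
  fix g assume approx: "\<exists>h. (\<exists>z. closed_graph h z) \<and> (\<forall>m\<ge>1. cmod (h m - g m) \<le> e)" if "e > 0" for e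
  show "\<exists>z. closed_graph g z"
  proof (rule closed_graph_complete)
    fix e :: real assume "e > 0"
    then obtain h w where h: "closed_graph h w" "\<And>m. m \<ge> 1 \<Longrightarrow> cmod (h m - g m) \<le> e"
      using approx by blast
    have "e \<le> e * \<omega> m" if "m \<ge> 1" for m
      using weight_ge_1[OF that] \<open>e > 0\<close> by simp
    then show "\<exists>h w. closed_graph h w \<and> (\<forall>m\<ge>1. cmod (h m - g m) \<le> e * \<omega> m)"
      using h order_trans by blast
  qed
qed

lemma closed_graph_finite_sum:
  assumes "\<And>k. k \<in> F \<Longrightarrow> closed_graph (g k) (z k)" "finite F"
  shows "closed_graph (\<lambda>m. \<Sum>k\<in>F. b k * g k m) (\<Sum>k\<in>F. b k * z k)"
  using assms(2,1)
proof (induction F)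
  case empty
  then show ?case by (simp add: closed_graph_zero)
next
  case (insert k F)
  then show ?case
    using closed_graph_lin[of "\<lambda>m. \<Sum>k\<in>F. b k * g k m" "\<Sum>k\<in>F. b k * z k" "g k" "z k" "b k"]
    by (simp add: add.commute)
qed

text \<open>The hypothesis is continuity along the curve of twists of \<open>\<psi>\<close>; it
  carries the formula from the decaying twists to the endpoint \<open>\<psi>\<close>.\<close>

theorem representation:
  assumes cont: "\<And>\<psi>. \<psi> \<in> char_seqs \<omega> \<Longrightarrow> continuous_on {0..} (\<lambda>s. \<tau> (\<lambda>n. \<psi> n * npow s n))"
  obtains a where "a \<in> l1_carrier \<omega>" "\<And>\<psi>. \<psi> \<in> char_seqs \<omega> \<Longrightarrow> \<tau> \<psi> = pairing a \<psi>"
proof -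
  obtain a' where a': "\<And>k. k \<ge> 1 \<Longrightarrow> closed_graph (unit_seq k) (a' k)"
    using closed_graph_unit_seq by metis
  define a where "a k = (if k = 0 then 0 else a' k)" for k
  have graph: "closed_graph (\<lambda>m. if m \<in> F then b m else 0) (\<Sum>k\<in>F. b k * a k)"
    if "finite F" "F \<subseteq> {1..}" for F b
  proof -
    have "closed_graph (unit_seq k) (a k)" if "k \<in> F" for k
      using a'[of k] \<open>F \<subseteq> {1..}\<close> that by (auto simp: a_def)
    then show ?thesis
      using closed_graph_finite_sum[of F unit_seq a b] \<open>finite F\<close> by (simp add: sum_unit_seq)
  qed
  have a: "a \<in> l1_carrier \<omega>"
  proof (rule l1_boundedI(1))
    fix F :: "nat set" assume F: "finite F" "F \<subseteq> {1..}"
    \<comment> \<open>The phase turns each \<open>b k * a k\<close> into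
      \<open>|a k| \<omega> k\<close>, while \<open>|b k| \<le> \<omega> k\<close> keeps the test
      sequence in the unit ball; hence the bound \<open>C\<close>, uniform in
      \<open>F\<close>.\<close>
    define b where "b k = cnj (sgn (a k)) * of_real (\<omega> k)" for k
    have sgn: "cnj (sgn w) * w = of_real (cmod w)" for w
      by (simp add: sgn_eq complex_norm_square[symmetric] power2_eq_square mult.commute)
    have b: "b k * a k = of_real (cmod (a k) * \<omega> k)" for k
    proof -
      have "b k * a k = (cnj (sgn (a k)) * a k) * of_real (\<omega> k)"
        by (simp add: b_def)
      then show ?thesis by (simp add: sgn)
    qed
    have "cmod (\<Sum>k\<in>F. b k * a k) \<le> C * 1"
    proof (rule closed_graph_bound[OF graph[OF F]])
      fix m :: nat assume "m \<ge> 1"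
      then show "cmod (if m \<in> F then b m else 0) \<le> 1 * \<omega> m"
        using weight_ge_1[of m] by (auto simp: b_def norm_mult norm_sgn)
    qed
    moreover have "(\<Sum>k\<in>F. b k * a k) = of_real (\<Sum>k\<in>F. cmod (a k) * \<omega> k)"
      by (simp add: b)
    ultimately show "(\<Sum>k\<in>F. cmod (a k) * \<omega> k) \<le> C"
      by (metis abs_ge_self mult.right_neutral norm_of_real order_trans)
  qed (simp add: a_def)
  have twisted: "\<tau> (\<lambda>n. \<psi> n * npow s n) = pairing a (\<lambda>n. \<psi> n * npow s n)"
    if \<psi>: "\<psi> \<in> char_seqs \<omega>" and "s > 0" for \<psi> s
  proof -
    define \<theta> where "\<theta> = (\<lambda>n. \<psi> n * npow s n)"
    have \<theta>: "\<theta> \<in> char_seqs \<omega>"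
      unfolding \<theta>_def using \<psi> \<open>s > 0\<close> by (intro char_seqs_npow) auto
    have "cmod (\<tau> \<theta> - pairing a \<theta>) \<le> 0"
    proof (rule field_le_epsilon)
      fix e' :: real assume "e' > 0"
      define e where "e = e' / (C + l1_norm \<omega> a + 1)"
      have e: "e > 0"
        using \<open>e' > 0\<close> C_nonneg l1_norm_nonneg[of a] by (simp add: e_def)
      have "C * e + e * l1_norm \<omega> a + e = (C + l1_norm \<omega> a + 1) * e"
        by (simp add: algebra_simps)
      also have "\<dots> = e'"
        using C_nonneg l1_norm_nonneg[of a] by (simp add: e_def)
      finally have e_le: "C * e + e * l1_norm \<omega> a \<le> e'"
        using e by simp
      \<comment> \<open>Here \<open>s > 0\<close> enters: as \<open>|\<psi>| \<le> \<omega>\<close>,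
        the tail of \<open>\<theta>\<close> beyond \<open>N\<close> is below \<open>e\<close>
        relative to the weight.\<close>
      have "((\<lambda>n. real n powr - s) \<longlongrightarrow> 0) sequentially"
        using \<open>s > 0\<close> by (intro tendsto_neg_powr filterlim_real_sequentially) auto
      then obtain N where N: "\<And>n. n \<ge> N \<Longrightarrow> real n powr - s < e"
        using order_tendstoD(2)[OF _ e] by (force simp: eventually_sequentially)
      define F where "F = {1..<N}"
      define t where "t = (\<lambda>m. if m \<in> F then \<theta> m else 0)"
      have F: "finite F" "F \<subseteq> {1..}" by (auto simp: F_def)
      have small: "cmod (\<theta> m - t m) \<le> e * \<omega> m" if "m \<ge> 1" for m
      proof (cases "m < N")
        case True
        then show ?thesis using that e weight_ge_1[OF that] by (simp add: t_def F_def)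
      next
        case False
        then have "cmod (\<theta> m) \<le> \<omega> m * e"
          unfolding \<theta>_def norm_mult using char_seqs_bound[OF \<psi> that] N[of m] weight_ge_1[OF that]
          by (intro mult_mono) (auto simp: npow_def)
        then show ?thesis using False by (simp add: t_def F_def mult.commute)
      qed
      have t: "cmod (t m) \<le> 1 * \<omega> m" if "m \<ge> 1" for m
        using char_seqs_bound[OF \<theta> that] weight_ge_1[OF that] by (auto simp: t_def)
      \<comment> \<open>Both \<open>\<tau> \<theta>\<close> and \<open>pairing a \<theta>\<close>
        are compared with the finite sum over \<open>F\<close>, with errors \<open>C * e\<close> and
        \<open>e * l1_norm \<omega> a\<close>.\<close>
      have "closed_graph (\<lambda>m. \<theta> m - t m) (\<tau> \<theta> - (\<Sum>k\<in>F. \<theta> k * a k))"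
        using closed_graph_lin[OF closed_graph_char[OF \<theta>] graph[OF F, of \<theta>], of "-1"]
        by (simp add: t_def)
      then have 1: "cmod (\<tau> \<theta> - (\<Sum>k\<in>F. \<theta> k * a k)) \<le> C * e"
        by (rule closed_graph_bound[OF _ small])
      have "pairing a t = (\<Sum>\<^sub>\<infinity>k\<in>F. \<theta> k * a k)"
        unfolding pairing_def using F by (intro infsum_cong_neutral) (auto simp: t_def)
      then have "pairing a t = (\<Sum>k\<in>F. \<theta> k * a k)"
        using F by simp
      then have "pairing a (\<lambda>m. \<theta> m - t m) = pairing a \<theta> - (\<Sum>k\<in>F. \<theta> k * a k)"
        using pairing_add_right[OF a small t] by simp
      then have 2: "cmod (pairing a \<theta> - (\<Sum>k\<in>F. \<theta> k * a k)) \<le> e * l1_norm \<omega> a"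
        using pairing_summable(3)[OF a small] by simp
      have "cmod (\<tau> \<theta> - pairing a \<theta>) \<le> C * e + e * l1_norm \<omega> a"
        using norm_triangle_ineq4[of "\<tau> \<theta> - (\<Sum>k\<in>F. \<theta> k * a k)" "pairing a \<theta> - (\<Sum>k\<in>F. \<theta> k * a k)"] 1 2
        by simp
      then show "cmod (\<tau> \<theta> - pairing a \<theta>) \<le> 0 + e'"
        using e_le by simp
    qed
    then show ?thesis by (simp add: \<theta>_def)
  qed
  have "\<tau> \<psi> = pairing a \<psi>" if \<psi>: "\<psi> \<in> char_seqs \<omega>" for \<psi>
  proof -
    define D where "D s = \<tau> (\<lambda>n. \<psi> n * npow s n) - pairing a (\<lambda>n. \<psi> n * npow s n)" for s
    have "continuous_on {0..} D"
      unfolding D_def by (intro continuous_on_diff cont continuous_on_pairing_npow \<psi> a)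
    then have "(D \<longlongrightarrow> D 0) (at 0 within {0..})"
      by (simp add: continuous_on_def)
    then have "(D \<longlongrightarrow> D 0) (at_right 0)"
      by (rule tendsto_within_subset) auto
    moreover have "(D \<longlongrightarrow> 0) (at_right 0)"
    proof (rule tendsto_eventually)
      show "\<forall>\<^sub>F s in at_right 0. D s = 0"
        unfolding eventually_at_filter by (auto simp: D_def twisted[OF \<psi>])
    qed
    ultimately have "D 0 = 0"
      using tendsto_unique trivial_limit_at_right_real by blast
    \<comment> \<open>At index 0 both sides vanish because \<open>\<psi> 0 = 0\<close>.\<close>
    moreover have "(\<lambda>n. \<psi> n * npow 0 n) = \<psi>"
      using \<psi> by (auto simp: npow_def char_seqs_def fun_eq_iff)
    ultimately show ?thesis by (simp add: D_def)
  qed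
  with a that show ?thesis by blast
qed

end

lemma has_sum_finite_sum:
  fixes f :: "'i \<Rightarrow> 'b \<Rightarrow> 'c::topological_comm_monoid_add"
  assumes "finite I" "\<And>i. i \<in> I \<Longrightarrow> (f i has_sum s i) A"
  shows "((\<lambda>n. \<Sum>i\<in>I. f i n) has_sum (\<Sum>i\<in>I. s i)) A"
  using assms by (induction I) (simp_all add: has_sum_add)

section \<open>Algebras isomorphic to the sequence algebra\<close>

text \<open>An isometric copy of the sequence algebra: \<open>\<kappa>\<close> is the identity for
  \<open>l1_alg\<close> and reads off the coefficients for \<open>dirichlet_alg\<close>. The Banach
  algebra laws are pulled back through this bijection.\<close>

locale coefficient_algebra = weighted_l1 +
  fixes A :: "'a complex_alg" and \<kappa> :: "'a \<Rightarrow> nat \<Rightarrow> complex"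
  assumes coeff_bij: "bij_betw \<kappa> (alg_carrier A) (l1_carrier \<omega>)"
    and zero_in: "alg_zero A \<in> alg_carrier A"
    and add_in: "\<lbrakk>x \<in> alg_carrier A; y \<in> alg_carrier A\<rbrakk> \<Longrightarrow> alg_add A x y \<in> alg_carrier A"
    and scale_in: "x \<in> alg_carrier A \<Longrightarrow> alg_scale A c x \<in> alg_carrier A"
    and mult_in: "\<lbrakk>x \<in> alg_carrier A; y \<in> alg_carrier A\<rbrakk> \<Longrightarrow> alg_mult A x y \<in> alg_carrier A"
    and coeff_zero: "\<kappa> (alg_zero A) = (\<lambda>n. 0)"
    and coeff_add: "\<lbrakk>x \<in> alg_carrier A; y \<in> alg_carrier A\<rbrakk> \<Longrightarrow> \<kappa> (alg_add A x y) = (\<lambda>n. \<kappa> x n + \<kappa> y n)"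
    and coeff_scale: "x \<in> alg_carrier A \<Longrightarrow> \<kappa> (alg_scale A c x) = (\<lambda>n. c * \<kappa> x n)"
    and coeff_mult: "\<lbrakk>x \<in> alg_carrier A; y \<in> alg_carrier A\<rbrakk> \<Longrightarrow> \<kappa> (alg_mult A x y) = dirichlet_conv (\<kappa> x) (\<kappa> y)"
    and norm_coeff: "x \<in> alg_carrier A \<Longrightarrow> alg_norm A x = l1_norm \<omega> (\<kappa> x)"
begin

lemma coeff_in [simp]: "x \<in> alg_carrier A \<Longrightarrow> \<kappa> x \<in> l1_carrier \<omega>"
  using coeff_bij by (auto simp: bij_betw_def)

lemma coeff_eqI: "\<lbrakk>x \<in> alg_carrier A; y \<in> alg_carrier A; \<kappa> x = \<kappa> y\<rbrakk> \<Longrightarrow> x = y"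
  using coeff_bij by (auto simp: bij_betw_def dest: inj_onD)

definition elem :: "(nat \<Rightarrow> complex) \<Rightarrow> 'a" where
  "elem = inv_into (alg_carrier A) \<kappa>"

lemma elem_in [simp]: "a \<in> l1_carrier \<omega> \<Longrightarrow> elem a \<in> alg_carrier A"
  and coeff_elem [simp]: "a \<in> l1_carrier \<omega> \<Longrightarrow> \<kappa> (elem a) = a"
  using coeff_bij unfolding elem_def bij_betw_def by (auto intro: inv_into_into f_inv_into_f)

lemma elem_coeff [simp]: "x \<in> alg_carrier A \<Longrightarrow> elem (\<kappa> x) = x"
  by (rule coeff_eqI) simp_all

lemma diff_in: "\<lbrakk>x \<in> alg_carrier A; y \<in> alg_carrier A\<rbrakk> \<Longrightarrow> alg_diff A x y \<in> alg_carrier A"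
  and coeff_diff: "\<lbrakk>x \<in> alg_carrier A; y \<in> alg_carrier A\<rbrakk> \<Longrightarrow> \<kappa> (alg_diff A x y) = (\<lambda>n. \<kappa> x n - \<kappa> y n)"
  by (simp_all add: alg_diff_def add_in scale_in coeff_add coeff_scale)

lemmas closed_simps = zero_in add_in scale_in mult_in diff_in
lemmas coeff_simps = coeff_zero coeff_add coeff_scale coeff_mult coeff_diff

sublocale comm_banach_algebra A
proof
  fix X :: "nat \<Rightarrow> 'a" assume X: "\<And>n. X n \<in> alg_carrier A"
    and Cauchy: "\<And>e::real. e > 0 \<Longrightarrow> \<exists>N. \<forall>m\<ge>N. \<forall>n\<ge>N. alg_norm A (alg_diff A (X m) (X n)) < e"
  have "\<exists>x\<in>l1_carrier \<omega>. (\<lambda>n. l1_norm \<omega> (\<lambda>k. \<kappa> (X n) k - x k)) \<longlonglongrightarrow> 0"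
  proof (rule l1_complete)
    fix e :: real assume "e > 0"
    then show "\<exists>N. \<forall>m\<ge>N. \<forall>n\<ge>N. l1_norm \<omega> (\<lambda>k. \<kappa> (X m) k - \<kappa> (X n) k) < e"
      using Cauchy[of e] by (simp add: X norm_coeff diff_in coeff_diff)
  qed (simp add: X)
  then obtain x where "x \<in> l1_carrier \<omega>" "(\<lambda>n. l1_norm \<omega> (\<lambda>k. \<kappa> (X n) k - x k)) \<longlonglongrightarrow> 0"
    by blast
  then show "\<exists>x\<in>alg_carrier A. (\<lambda>n. alg_norm A (alg_diff A (X n) x)) \<longlonglongrightarrow> 0"
    by (intro bexI[of _ "elem x"]) (simp_all add: X norm_coeff diff_in coeff_diff)
next
  fix x assume x: "x \<in> alg_carrier A"
  show "alg_norm A x = 0 \<longleftrightarrow> x = alg_zero A"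
    using coeff_eqI[OF x zero_in] coeff_zero l1_norm_eq_0_iff[of "\<kappa> x"] x
    by (auto simp: norm_coeff)
next
  fix x y z assume "x \<in> alg_carrier A" "y \<in> alg_carrier A" "z \<in> alg_carrier A"
  then show "alg_mult A (alg_mult A x y) z = alg_mult A x (alg_mult A y z)"
    by (intro coeff_eqI) (simp_all add: closed_simps coeff_simps dirichlet_conv_assoc)
next
  fix x y assume "x \<in> alg_carrier A" "y \<in> alg_carrier A"
  then show "alg_mult A x y = alg_mult A y x"
    by (intro coeff_eqI) (simp_all add: closed_simps coeff_simps dirichlet_conv_commute)
qed ((rule coeff_eqI closed_simps; simp add: closed_simps coeff_simps algebra_simps
      dirichlet_conv_add_right dirichlet_conv_scale_right)+,
    simp_all add: closed_simps coeff_simps norm_coeff l1_norm_nonneg l1_add l1_scale l1_conv)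

definition one :: 'a where
  "one = elem (unit_seq 1)"

lemma one_in: "one \<in> alg_carrier A"
  by (simp add: one_def unit_seq_in_l1)

lemma mult_one: "x \<in> alg_carrier A \<Longrightarrow> alg_mult A x one = x"
  by (rule coeff_eqI)
    (simp_all add: one_def unit_seq_in_l1 closed_simps coeff_simps dirichlet_conv_unit del: One_nat_def)

lemma one_mult: "x \<in> alg_carrier A \<Longrightarrow> alg_mult A one x = x"
  using mult_one mult_commute[OF one_in] by simp

lemma without_order: "without_order A"
  unfolding without_order_def using mult_one one_in by metis

definition char_of :: "(nat \<Rightarrow> complex) \<Rightarrow> 'a \<Rightarrow> complex" where
  "char_of \<psi> = (\<lambda>x\<in>alg_carrier A. pairing (\<kappa> x) \<psi>)"

lemma char_of_in_spectrum:
  assumes "\<psi> \<in> char_seqs \<omega>"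
  shows "char_of \<psi> \<in> spectrum_space A"
proof -
  note \<Phi> = l1_character_pairing[OF assms, unfolded l1_character_def]
  obtain a where "a \<in> l1_carrier \<omega>" "pairing a \<psi> \<noteq> 0"
    using \<Phi> by blast
  then have "\<exists>x\<in>alg_carrier A. pairing (\<kappa> x) \<psi> \<noteq> 0"
    by (intro bexI[of _ "elem a"]) simp_all
  then show ?thesis
    using \<Phi> by (simp add: spectrum_space_def char_of_def closed_simps coeff_simps)
qed

lemma spectrum_eq: "spectrum_space A = char_of ` char_seqs \<omega>"
proof
  show "spectrum_space A \<subseteq> char_of ` char_seqs \<omega>"
  proof
    fix \<phi> assume \<phi>: "\<phi> \<in> spectrum_space A"
    have "l1_character (\<lambda>a. \<phi> (elem a))"
      unfolding l1_character_def
    proof (intro conjI ballI allI)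
      fix a b c assume a: "a \<in> l1_carrier \<omega>" and b: "b \<in> l1_carrier \<omega>"
      have "elem (\<lambda>n. a n + b n) = alg_add A (elem a) (elem b)"
        "elem (dirichlet_conv a b) = alg_mult A (elem a) (elem b)"
        using a b by (auto intro!: coeff_eqI simp: closed_simps coeff_simps l1_add l1_conv)
      then show "\<phi> (elem (\<lambda>n. a n + b n)) = \<phi> (elem a) + \<phi> (elem b)"
        "\<phi> (elem (dirichlet_conv a b)) = \<phi> (elem a) * \<phi> (elem b)"
        using \<phi> a b by (auto simp: spectrum_space_def)
    next
      fix c a assume a: "a \<in> l1_carrier \<omega>"
      have "elem (\<lambda>n. c * a n) = alg_scale A c (elem a)"
        using a by (auto intro!: coeff_eqI simp: closed_simps coeff_simps l1_scale)
      then show "\<phi> (elem (\<lambda>n. c * a n)) = c * \<phi> (elem a)"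
        using \<phi> a by (auto simp: spectrum_space_def)
    next
      obtain x where "x \<in> alg_carrier A" "\<phi> x \<noteq> 0"
        using \<phi> by (auto simp: spectrum_space_def)
      then show "\<exists>a\<in>l1_carrier \<omega>. \<phi> (elem a) \<noteq> 0"
        by (intro bexI[of _ "\<kappa> x"]) simp_all
    qed
    then obtain \<psi> where \<psi>: "\<psi> \<in> char_seqs \<omega>"
      and eq: "\<And>a. a \<in> l1_carrier \<omega> \<Longrightarrow> \<phi> (elem a) = pairing a \<psi>"
      by (rule l1_character_eq_pairing) blast
    have "\<phi> x = char_of \<psi> x" for x
      using eq[of "\<kappa> x"] \<phi> by (cases "x \<in> alg_carrier A") (auto simp: char_of_def spectrum_space_def extensional_def)
    then show "\<phi> \<in> char_of ` char_seqs \<omega>"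
      using \<psi> by (auto simp: fun_eq_iff)
  qed
qed (auto intro: char_of_in_spectrum)

lemma spectrum_norm_le:
  assumes "\<phi> \<in> spectrum_space A" "x \<in> alg_carrier A"
  shows "cmod (\<phi> x) \<le> alg_norm A x"
proof -
  obtain \<psi> where "\<psi> \<in> char_seqs \<omega>" "\<phi> = char_of \<psi>"
    using assms(1) by (auto simp: spectrum_eq)
  then show ?thesis
    using l1_character_norm_le[OF l1_character_pairing, of \<psi> "\<kappa> x"] assms(2)
    by (simp add: char_of_def norm_coeff)
qed

lemma spectrum_one:
  assumes "\<phi> \<in> spectrum_space A"
  shows "\<phi> one = 1"
proof -
  obtain \<psi> where "\<psi> \<in> char_seqs \<omega>" "\<phi> = char_of \<psi>"
    using assms by (auto simp: spectrum_eq)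
  then show ?thesis
    using one_in by (simp add: char_of_def) (simp add: one_def unit_seq_in_l1 pairing_unit_seq_left char_seqs_def)
qed

section \<open>The Gel'fand topology, the dual norm and the BSE property\<close>

lemma topspace_gelfand: "topspace (gelfand_topology A) = spectrum_space A"
  unfolding gelfand_topology_def topology_generated_by_topspace using zero_in by auto

lemma continuous_map_gelfand:
  assumes "x \<in> alg_carrier A"
  shows "continuous_map (gelfand_topology A) euclidean (gelfand A x)"
  unfolding continuous_map_def topspace_gelfand
proof (intro conjI allI impI)
  fix U :: "complex set" assume "openin euclidean U"
  then show "openin (gelfand_topology A) {\<phi> \<in> spectrum_space A. gelfand A x \<phi> \<in> U}"
    unfolding gelfand_topology_def using assms by (intro topology_generated_by_Basis) auto
qed simp

text \<open>The universal property of the weakest topology: continuity is tested by evaluation at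
  each element.\<close>

lemma continuous_map_into_gelfand:
  assumes "f ` topspace T \<subseteq> spectrum_space A"
    and "\<And>x. x \<in> alg_carrier A \<Longrightarrow> continuous_map T euclidean (\<lambda>t. f t x)"
  shows "continuous_map T (gelfand_topology A) f"
  unfolding gelfand_topology_def
proof (rule continuous_on_generated_topo)
  fix V assume "V \<in> {{\<phi> \<in> spectrum_space A. gelfand A a \<phi> \<in> U} | a U. a \<in> alg_carrier A \<and> open U}"
  then obtain x U where x: "x \<in> alg_carrier A" and U: "open U"
    and V: "V = {\<phi> \<in> spectrum_space A. gelfand A x \<phi> \<in> U}" by blast
  have "f -` V \<inter> topspace T = {t \<in> topspace T. f t x \<in> U}"
    using assms(1) by (auto simp: V gelfand_def)
  then show "openin T (f -` V \<inter> topspace T)"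
    using openin_continuous_map_preimage[OF assms(2)[OF x]] U by simp
next
  show "f ` topspace T \<subseteq> \<Union> {{\<phi> \<in> spectrum_space A. gelfand A a \<phi> \<in> U} | a U. a \<in> alg_carrier A \<and> open U}"
    using assms(1) topspace_gelfand unfolding gelfand_topology_def topology_generated_by_topspace by simp
qed

text \<open>Divide \<open>x\<close> by \<open>alg_norm A x + 1\<close> to enter the unit ball. The
  added 1 keeps the divisor, and later the BSE constant, positive even for \<open>x = 0\<close>.
  Contractivity of characters bounds the set whose supremum is the dual norm.\<close>

lemma dual_norm_bound:
  fixes \<phi> :: "nat \<Rightarrow> 'a \<Rightarrow> complex"
  assumes \<phi>: "\<And>i. i \<in> I \<Longrightarrow> \<phi> i \<in> spectrum_space A" and x: "x \<in> alg_carrier A"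
  shows "cmod (\<Sum>i\<in>I. c i * \<phi> i x) \<le> (alg_norm A x + 1) * dual_norm A (\<lambda>a. \<Sum>i\<in>I. c i * \<phi> i a)"
proof -
  define r where "r = alg_norm A x + 1"
  have r: "r > 0"
    using norm_nonneg[OF x] by (simp add: r_def)
  define y where "y = alg_scale A (of_real (1 / r)) x"
  have y: "y \<in> alg_carrier A" "alg_norm A y \<le> 1"
    using r x norm_scale[OF x, of "of_real (1 / r)"] norm_nonneg[OF x]
    by (auto simp: y_def scale_in norm_divide r_def)
  have "\<phi> i y = of_real (1 / r) * \<phi> i x" if "i \<in> I" for i
    using \<phi>[OF that] x by (simp add: spectrum_space_def y_def)
  then have "(\<Sum>i\<in>I. c i * \<phi> i y) = of_real (1 / r) * (\<Sum>i\<in>I. c i * \<phi> i x)"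
    by (simp add: sum_distrib_left mult_ac)
  then have "cmod (\<Sum>i\<in>I. c i * \<phi> i x) = r * cmod (\<Sum>i\<in>I. c i * \<phi> i y)"
    using r by (simp add: Real_Vector_Spaces.norm_mult norm_divide)
  also have "\<dots> \<le> r * dual_norm A (\<lambda>a. \<Sum>i\<in>I. c i * \<phi> i a)"
  proof (intro mult_left_mono)
    show "cmod (\<Sum>i\<in>I. c i * \<phi> i y) \<le> dual_norm A (\<lambda>a. \<Sum>i\<in>I. c i * \<phi> i a)"
      unfolding dual_norm_def
    proof (rule cSUP_upper)
      show "bdd_above ((\<lambda>a. cmod (\<Sum>i\<in>I. c i * \<phi> i a)) ` {a \<in> alg_carrier A. alg_norm A a \<le> 1})"
      proof (rule bdd_aboveI2)
        fix a assume a: "a \<in> {a \<in> alg_carrier A. alg_norm A a \<le> 1}"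
        have "cmod (c i * \<phi> i a) \<le> cmod (c i)" if "i \<in> I" for i
          using spectrum_norm_le[OF \<phi>[OF that], of a] a
            mult_left_mono[of "cmod (\<phi> i a)" 1 "cmod (c i)"] by (simp add: Real_Vector_Spaces.norm_mult)
        then show "cmod (\<Sum>i\<in>I. c i * \<phi> i a) \<le> (\<Sum>i\<in>I. cmod (c i))"
          by (rule sum_norm_le)
      qed
    qed (use y in simp)
  qed (use r in simp)
  finally show ?thesis by (simp add: r_def)
qed

lemma gelfand_BSE:
  assumes x: "x \<in> alg_carrier A"
  shows "gelfand A x \<in> BSE_functions A"
proof -
  have "cmod (\<Sum>i=1..n. c i * gelfand A x (\<phi> i))
      \<le> (alg_norm A x + 1) * dual_norm A (\<lambda>a. \<Sum>i=1..n. c i * \<phi> i a)"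
    if "\<forall>i\<in>{1..n}. \<phi> i \<in> spectrum_space A" for n c and \<phi> :: "nat \<Rightarrow> 'a \<Rightarrow> complex"
  proof -
    have "(\<Sum>i=1..n. c i * gelfand A x (\<phi> i)) = (\<Sum>i=1..n. c i * \<phi> i x)"
      using that by (intro sum.cong) (auto simp: gelfand_def)
    then show ?thesis
      using dual_norm_bound[of "{1..n}" \<phi> x c] that x by simp
  qed
  moreover have "alg_norm A x + 1 > 0"
    using norm_nonneg[OF x] by simp
  ultimately show ?thesis
    unfolding BSE_functions_def using continuous_map_gelfand[OF x]
    by (auto simp: gelfand_def)
qed

text \<open>A combination of characters is the pairing with the same combination of their sequences,
  so a weighted bound on the latter bounds the dual norm. This turns the BSE inequality into the
  assumption \<open>bse\<close>.\<close>

lemma dual_norm_char_of_le: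
  assumes I: "finite I" "I \<subseteq> char_seqs \<omega>"
    and K: "\<And>m. m \<ge> 1 \<Longrightarrow> cmod (\<Sum>\<psi>\<in>I. c \<psi> * \<psi> m) \<le> K * \<omega> m"
  shows "dual_norm A (\<lambda>x. \<Sum>\<psi>\<in>I. c \<psi> * char_of \<psi> x) \<le> K"
  unfolding dual_norm_def
proof (rule cSUP_least)
  have "alg_norm A (alg_zero A) = 0"
    using norm_eq_zero[OF zero_in] by simp
  then show "{a \<in> alg_carrier A. alg_norm A a \<le> 1} \<noteq> {}"
    using zero_in by force
  fix x assume "x \<in> {a \<in> alg_carrier A. alg_norm A a \<le> 1}"
  then have x: "x \<in> alg_carrier A" "alg_norm A x \<le> 1" by auto
  have K0: "K \<ge> 0"
    using order_trans[OF norm_ge_zero K[of 1]] weight_ge_1[of 1] by (simp add: zero_le_mult_iff)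
  have "((\<lambda>n. \<Sum>\<psi>\<in>I. \<kappa> x n * (c \<psi> * \<psi> n)) has_sum (\<Sum>\<psi>\<in>I. c \<psi> * pairing (\<kappa> x) \<psi>)) {1..}"
  proof (rule has_sum_finite_sum[OF I(1)])
    fix \<psi> assume "\<psi> \<in> I"
    then have bound: "cmod (\<psi> n) \<le> 1 * \<omega> n" if "n \<ge> 1" for n
      using char_seqs_bound I(2) that by blast
    have "((\<lambda>n. \<kappa> x n * \<psi> n) has_sum pairing (\<kappa> x) \<psi>) {1..}"
      unfolding pairing_def by (rule has_sum_infsum[OF pairing_summable(2)[OF coeff_in[OF x(1)] bound]])
    from has_sum_cmult_right[OF this, of "c \<psi>"]
    show "((\<lambda>n. \<kappa> x n * (c \<psi> * \<psi> n)) has_sum c \<psi> * pairing (\<kappa> x) \<psi>) {1..}"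
      by (simp add: mult.left_commute)
  qed
  then have "(\<Sum>\<psi>\<in>I. c \<psi> * char_of \<psi> x) = pairing (\<kappa> x) (\<lambda>n. \<Sum>\<psi>\<in>I. c \<psi> * \<psi> n)"
    using x(1) by (simp add: char_of_def pairing_def sum_distrib_left infsumI)
  then have "cmod (\<Sum>\<psi>\<in>I. c \<psi> * char_of \<psi> x) \<le> K * l1_norm \<omega> (\<kappa> x)"
    using pairing_summable(3)[OF coeff_in[OF x(1)] K] by simp
  also have "\<dots> \<le> K"
    using x K0 mult_left_mono[of "alg_norm A x" 1 K] by (simp add: norm_coeff)
  finally show "cmod (\<Sum>\<psi>\<in>I. c \<psi> * char_of \<psi> x) \<le> K" .
qed

lemma BSE_gelfand:
  assumes \<sigma>: "\<sigma> \<in> BSE_functions A"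
  shows "\<exists>x\<in>alg_carrier A. \<sigma> = gelfand A x"
proof -
  have ext: "\<sigma> \<in> extensional (spectrum_space A)"
    and cont: "continuous_map (gelfand_topology A) euclidean \<sigma>"
    using \<sigma> by (auto simp: BSE_functions_def)
  obtain C where C: "C > 0"
    and bse: "\<And>(n::nat) \<phi> c. n \<ge> 1 \<Longrightarrow> (\<forall>i\<in>{1..n}. \<phi> i \<in> spectrum_space A) \<Longrightarrow>
      cmod (\<Sum>i=1..n. c i * \<sigma> (\<phi> i)) \<le> C * dual_norm A (\<lambda>a. \<Sum>i=1..n. c i * \<phi> i a)"
    using \<sigma> unfolding BSE_functions_def by blast
  interpret bounded_on_characters \<omega> "\<lambda>\<psi>. \<sigma> (char_of \<psi>)" C
  proof unfold_locales
    show "C \<ge> 0" using C by simp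
    fix I c K assume I: "finite I" "I \<subseteq> char_seqs \<omega>"
      and K: "\<And>m. m \<ge> 1 \<Longrightarrow> cmod (\<Sum>\<psi>\<in>I. c \<psi> * \<psi> m) \<le> K * \<omega> m"
    show "cmod (\<Sum>\<psi>\<in>I. c \<psi> * \<sigma> (char_of \<psi>)) \<le> C * K"
    proof (cases "I = {}")
      \<comment> \<open>The BSE condition speaks of families with \<open>n \<ge> 1\<close>, so the
        empty combination is treated apart.\<close>
      case True
      have "K \<ge> 0"
        using order_trans[OF norm_ge_zero K[of 1]] weight_ge_1[of 1] by (simp add: zero_le_mult_iff)
      then show ?thesis using True C by simp
    next
      case False
      obtain h where h: "bij_betw h {1..card I} I"
        using ex_bij_betw_nat_finite_1[OF I(1)] by blast
      have "card I \<ge> 1"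
        using False I(1) by (simp add: Suc_le_eq card_gt_0_iff)
      moreover have "\<forall>i\<in>{1..card I}. char_of (h i) \<in> spectrum_space A"
        using bij_betwE[OF h] I(2) char_of_in_spectrum by blast
      ultimately have "cmod (\<Sum>i=1..card I. c (h i) * \<sigma> (char_of (h i)))
          \<le> C * dual_norm A (\<lambda>x. \<Sum>i=1..card I. c (h i) * char_of (h i) x)"
        by (rule bse)
      also have "(\<lambda>x. \<Sum>i=1..card I. c (h i) * char_of (h i) x) = (\<lambda>x. \<Sum>\<psi>\<in>I. c \<psi> * char_of \<psi> x)"
      proof
        fix x show "(\<Sum>i=1..card I. c (h i) * char_of (h i) x) = (\<Sum>\<psi>\<in>I. c \<psi> * char_of \<psi> x)"
          by (rule sum.reindex_bij_betw[OF h, of "\<lambda>\<psi>. c \<psi> * char_of \<psi> x"])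
      qed
      also have "(\<Sum>i=1..card I. c (h i) * \<sigma> (char_of (h i))) = (\<Sum>\<psi>\<in>I. c \<psi> * \<sigma> (char_of \<psi>))"
        by (rule sum.reindex_bij_betw[OF h])
      also have "C * dual_norm A (\<lambda>x. \<Sum>\<psi>\<in>I. c \<psi> * char_of \<psi> x) \<le> C * K"
        using C by (intro mult_left_mono dual_norm_char_of_le I K) auto
      finally show ?thesis .
    qed
  qed
  obtain a where a: "a \<in> l1_carrier \<omega>" and eq: "\<And>\<psi>. \<psi> \<in> char_seqs \<omega> \<Longrightarrow> \<sigma> (char_of \<psi>) = pairing a \<psi>"
  proof (rule representation)
    fix \<psi> assume \<psi>: "\<psi> \<in> char_seqs \<omega>"
    have "continuous_map (top_of_set {0..}) (gelfand_topology A) (\<lambda>s. char_of (\<lambda>n. \<psi> n * npow s n))"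
    proof (rule continuous_map_into_gelfand)
      show "(\<lambda>s. char_of (\<lambda>n. \<psi> n * npow s n)) ` topspace (top_of_set {0..}) \<subseteq> spectrum_space A"
        using char_of_in_spectrum[OF char_seqs_npow[OF \<psi>]] by auto
      fix x assume "x \<in> alg_carrier A"
      then show "continuous_map (top_of_set {0..}) euclidean (\<lambda>s. char_of (\<lambda>n. \<psi> n * npow s n) x)"
        using continuous_on_pairing_npow[OF coeff_in \<psi>] by (simp add: char_of_def)
    qed
    from continuous_map_compose[OF this cont]
    show "continuous_on {0..} (\<lambda>s. \<sigma> (char_of (\<lambda>n. \<psi> n * npow s n)))"
      by (simp add: o_def)
  qed blast
  have "\<sigma> \<phi> = gelfand A (elem a) \<phi>" for \<phi>
  proof (cases "\<phi> \<in> spectrum_space A")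
    case True
    then obtain \<psi> where "\<psi> \<in> char_seqs \<omega>" "\<phi> = char_of \<psi>"
      by (auto simp: spectrum_eq)
    then show ?thesis
      using True eq a by (simp add: gelfand_def char_of_def)
  next
    case False
    then show ?thesis using ext by (simp add: extensional_def gelfand_def)
  qed
  then show ?thesis
    using a by (intro bexI[of _ "elem a"]) (auto simp: fun_eq_iff)
qed

text \<open>A multiplier is multiplication by its value at the unit. Every character is 1 at the
  unit, so the identity at \<open>a = one\<close> already forces \<open>\<sigma>\<close>, which
  settles the definite description.\<close>

lemma multiplier_transform_eq:
  assumes T: "T \<in> multipliers A"
  shows "multiplier_transform A T = gelfand A (T one)"
  unfolding multiplier_transform_def
proof (rule the_equality)
  have T1: "T one \<in> alg_carrier A" and T_in: "\<And>x. x \<in> alg_carrier A \<Longrightarrow> T x \<in> alg_carrier A"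
    using T one_in by (auto simp: multipliers_def)
  have T_eq: "T x = alg_mult A (T one) x" if "x \<in> alg_carrier A" for x
    using T that one_in one_mult[OF that] by (force simp: multipliers_def)
  have "gelfand A (T x) \<phi> = gelfand A (T one) \<phi> * gelfand A x \<phi>"
    if "x \<in> alg_carrier A" "\<phi> \<in> spectrum_space A" for x \<phi>
    using T_eq[OF that(1)] that T1 by (simp add: gelfand_def spectrum_space_def)
  moreover have "bounded (gelfand A (T one) ` spectrum_space A)"
    using spectrum_norm_le[OF _ T1] by (auto simp: bounded_iff gelfand_def)
  ultimately show "gelfand A (T one) \<in> extensional (spectrum_space A) \<and>
      continuous_map (gelfand_topology A) euclidean (gelfand A (T one)) \<and>
      bounded (gelfand A (T one) ` spectrum_space A) \<and>
      (\<forall>a\<in>alg_carrier A. \<forall>\<phi>\<in>spectrum_space A. gelfand A (T a) \<phi> = gelfand A (T one) \<phi> * gelfand A a \<phi>)"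
    using continuous_map_gelfand[OF T1] by (simp add: gelfand_def)
next
  fix \<sigma> assume \<sigma>: "\<sigma> \<in> extensional (spectrum_space A) \<and>
     continuous_map (gelfand_topology A) euclidean \<sigma> \<and>
     bounded (\<sigma> ` spectrum_space A) \<and>
     (\<forall>a\<in>alg_carrier A. \<forall>\<phi>\<in>spectrum_space A. gelfand A (T a) \<phi> = \<sigma> \<phi> * gelfand A a \<phi>)"
  show "\<sigma> = gelfand A (T one)"
  proof
    fix \<phi> show "\<sigma> \<phi> = gelfand A (T one) \<phi>"
    proof (cases "\<phi> \<in> spectrum_space A")
      case True
      then have "gelfand A (T one) \<phi> = \<sigma> \<phi> * gelfand A one \<phi>"
        using \<sigma> one_in by blast
      then show ?thesis
        using True spectrum_one by (simp add: gelfand_def)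
    next
      case False
      then show ?thesis
        using \<sigma> by (simp add: gelfand_def extensional_def)
    qed
  qed
qed

theorem BSE: "BSE_algebra A"
proof -
  have "multiplier_transform A ` multipliers A = gelfand A ` alg_carrier A"
  proof
    show "multiplier_transform A ` multipliers A \<subseteq> gelfand A ` alg_carrier A"
    proof
      fix \<sigma> assume "\<sigma> \<in> multiplier_transform A ` multipliers A"
      then obtain T where "T \<in> multipliers A" "\<sigma> = gelfand A (T one)"
        using multiplier_transform_eq by auto
      then show "\<sigma> \<in> gelfand A ` alg_carrier A"
        using one_in by (auto simp: multipliers_def)
    qed
    show "gelfand A ` alg_carrier A \<subseteq> multiplier_transform A ` multipliers A"
    proof
      fix \<sigma> assume "\<sigma> \<in> gelfand A ` alg_carrier A"
      then obtain x where x: "x \<in> alg_carrier A" and \<sigma>: "\<sigma> = gelfand A x" by blast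
      define T where "T = (\<lambda>y\<in>alg_carrier A. alg_mult A x y)"
      have "T \<in> multipliers A"
        unfolding multipliers_def T_def using x
        by (auto simp: mult_in mult_assoc) (metis mult_assoc mult_commute)
      moreover have "T one = x"
        using one_in mult_one[OF x] by (simp add: T_def)
      ultimately show "\<sigma> \<in> multiplier_transform A ` multipliers A"
        using multiplier_transform_eq[of T] \<sigma> by force
    qed
  qed
  moreover have "BSE_functions A = gelfand A ` alg_carrier A"
    using BSE_gelfand gelfand_BSE by (intro equalityI subsetI) (auto simp: image_iff Bex_def)
  ultimately show ?thesis
    unfolding BSE_algebra_def by (simp add: comm_banach_algebra_axioms without_order)
qed

end

section \<open>The sequence algebra and the algebra of Dirichlet series\<close>

context weighted_l1
begin

lemma coefficient_algebra_l1_alg: "coefficient_algebra \<omega> (l1_alg \<omega>) (\<lambda>a. a)"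
  by unfold_locales (simp_all add: l1_alg_def l1_zero l1_add l1_scale l1_conv bij_betw_def inj_on_def)

lemma nat_powr_bound:
  assumes "s \<in> half_plane" "n \<ge> 1"
  shows "cmod (of_nat n powr - s) \<le> 1 * \<omega> n"
proof -
  have "cmod (of_nat n powr - s) = cmod (npow (Re s) n)"
    using assms(2) norm_powr_real_powr[of "of_nat n" "- s"] by (simp add: npow_def)
  also have "\<dots> \<le> 1 * \<omega> n"
    using assms by (intro npow_bound) (auto simp: half_plane_def)
  finally show ?thesis .
qed

lemma nat_powr_mult: "of_nat (m * n) powr - s = of_nat m powr - s * (of_nat n powr - s :: complex)"
  using powr_times_real[of "of_nat m" "of_nat n" "- s"] by simp

text \<open>On the half-plane \<open>n\<^sup>-\<^sup>s\<close> has modulus at most 1, hence at most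
  \<open>\<omega> n\<close>, so the series converges automatically and only its value remains to be
  prescribed.\<close>

lemma dirichlet_rep_iff:
  "dirichlet_rep \<omega> a f \<longleftrightarrow>
    a \<in> l1_carrier \<omega> \<and> (\<forall>s\<in>half_plane. f s = pairing a (\<lambda>n. of_nat n powr - s))"
  using pairing_summable(2)[OF _ nat_powr_bound]
  unfolding dirichlet_rep_def pairing_def by (auto simp: has_sum_iff)

lemma dirichlet_rep_unique:
  assumes "dirichlet_rep \<omega> a f" "dirichlet_rep \<omega> b f"
  shows "a = b"
proof (rule l1_eqI)
  fix s :: real assume "s > 0"
  have "pairing c (npow s) = pairing c (\<lambda>n. of_nat n powr - of_real s)" for c
    unfolding pairing_def npow_def by (intro infsum_cong) (simp add: powr_of_real[symmetric])
  then show "pairing a (npow s) = pairing b (npow s)"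
    using assms \<open>s > 0\<close> by (simp add: dirichlet_rep_iff half_plane_def)
qed (use assms in \<open>simp_all add: dirichlet_rep_iff\<close>)

lemma dirichlet_coeff_eq: "dirichlet_rep \<omega> a f \<Longrightarrow> (THE a. dirichlet_rep \<omega> a f) = a"
  by (rule the_equality) (auto intro: dirichlet_rep_unique)

lemma coefficient_algebra_dirichlet_alg:
  "coefficient_algebra \<omega> (dirichlet_alg \<omega>) (\<lambda>f. THE a. dirichlet_rep \<omega> a f)"
proof -
  define H where "H = {f \<in> extensional half_plane. \<exists>a. dirichlet_rep \<omega> a f}"
  define \<kappa> where "\<kappa> f = (THE a. dirichlet_rep \<omega> a f)" for f
  have carrier: "alg_carrier (dirichlet_alg \<omega>) = H"
    by (simp add: dirichlet_alg_def H_def)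
  have rep: "dirichlet_rep \<omega> (\<kappa> f) f" if "f \<in> H" for f
    using that dirichlet_coeff_eq unfolding H_def \<kappa>_def by auto
  have l1: "\<kappa> f \<in> l1_carrier \<omega>"
    and val: "s \<in> half_plane \<Longrightarrow> f s = pairing (\<kappa> f) (\<lambda>n. of_nat n powr - s)" if "f \<in> H" for f s
    using rep[OF that] by (auto simp: dirichlet_rep_iff)
  \<comment> \<open>By uniqueness of coefficients, exhibiting a series for \<open>f\<close> proves
    membership and computes \<open>\<kappa> f\<close> at once; all operations below are handled this
    way.\<close>
  have I: "f \<in> H \<and> \<kappa> f = a"
    if "a \<in> l1_carrier \<omega>" "f \<in> extensional half_plane"
      "\<And>s. s \<in> half_plane \<Longrightarrow> f s = pairing a (\<lambda>n. of_nat n powr - s)" for a f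
  proof -
    have "dirichlet_rep \<omega> a f"
      using that by (simp add: dirichlet_rep_iff)
    then show ?thesis
      using that(2) dirichlet_coeff_eq by (auto simp: H_def \<kappa>_def)
  qed
  have zero: "(\<lambda>s\<in>half_plane. 0) \<in> H \<and> \<kappa> (\<lambda>s\<in>half_plane. 0) = (\<lambda>n. 0)"
    by (rule I) (simp_all add: l1_zero pairing_def)
  have add: "(\<lambda>s\<in>half_plane. f s + g s) \<in> H \<and>
      \<kappa> (\<lambda>s\<in>half_plane. f s + g s) = (\<lambda>n. \<kappa> f n + \<kappa> g n)" if "f \<in> H" "g \<in> H" for f g
    by (rule I) (simp_all add: l1_add l1 that pairing_add_left[OF l1 l1 nat_powr_bound] val)
  have scale: "(\<lambda>s\<in>half_plane. c * f s) \<in> H \<and>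
      \<kappa> (\<lambda>s\<in>half_plane. c * f s) = (\<lambda>n. c * \<kappa> f n)" if "f \<in> H" for f c
    by (rule I) (simp_all add: l1_scale l1 that pairing_scale_left val)
  have mult: "(\<lambda>s\<in>half_plane. f s * g s) \<in> H \<and>
      \<kappa> (\<lambda>s\<in>half_plane. f s * g s) = dirichlet_conv (\<kappa> f) (\<kappa> g)" if "f \<in> H" "g \<in> H" for f g
    by (rule I) (simp_all add: l1_conv l1 that pairing_conv[OF l1 l1 nat_powr_mult nat_powr_bound] val)
  have bij: "bij_betw \<kappa> H (l1_carrier \<omega>)"
  proof (rule bij_betw_imageI)
    show "inj_on \<kappa> H"
    proof (rule inj_onI)
      fix f g assume f: "f \<in> H" and g: "g \<in> H" and "\<kappa> f = \<kappa> g"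
      then have "f s = g s" if "s \<in> half_plane" for s
        using val[OF f that] val[OF g that] by simp
      then show "f = g"
        using f g by (auto simp: H_def intro: extensionalityI)
    qed
    show "\<kappa> ` H = l1_carrier \<omega>"
    proof
      show "l1_carrier \<omega> \<subseteq> \<kappa> ` H"
      proof
        fix a assume "a \<in> l1_carrier \<omega>"
        then have "(\<lambda>s\<in>half_plane. pairing a (\<lambda>n. of_nat n powr - s)) \<in> H \<and>
            \<kappa> (\<lambda>s\<in>half_plane. pairing a (\<lambda>n. of_nat n powr - s)) = a"
          by (intro I) simp_all
        then show "a \<in> \<kappa> ` H" by (metis imageI)
      qed
    qed (use l1 in auto)
  qed
  have "coefficient_algebra \<omega> (dirichlet_alg \<omega>) \<kappa>"
  proof unfold_locales
    show "bij_betw \<kappa> (alg_carrier (dirichlet_alg \<omega>)) (l1_carrier \<omega>)"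
      using bij by (simp add: carrier)
  qed (use zero add scale mult in \<open>simp_all add: carrier\<close>, simp_all add: dirichlet_alg_def \<kappa>_def)
  then show ?thesis
    by (simp add: \<kappa>_def[abs_def])
qed

end

theorem theorem2p2:
  fixes \<omega> :: "nat \<Rightarrow> real"
  assumes "weight \<omega>"
  shows "BSE_algebra (dirichlet_alg \<omega>) \<and> BSE_algebra (l1_alg \<omega>)"
proof -
  interpret weighted_l1 \<omega>
    by unfold_locales (rule assms)
  show ?thesis
    by (intro conjI coefficient_algebra.BSE[OF coefficient_algebra_dirichlet_alg]
        coefficient_algebra.BSE[OF coefficient_algebra_l1_alg])
qed

end
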